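(* There exist universal constants $\bar c,C>0$ such that the following holds. For every $n\ge 1$, every finite $n$-player game with losses in $[0,1]$ in which player $i$ has $d_i\ge1$ actions, and every integer $T\ge1$, if all players use Optimistic Hedge (under exact expected loss-vector feedback) with the common constant step size $\eta_T=\bar c/[\sqrt n\,\log(T+2)]$, then for every player $i$, $$\mathrm{Reg}_i(T)\le C\sqrt n\,\log d_i\,\log(T+2).$$
   Context: Game. There are $n$ players; player $i\in[n]$ has action set $A_i=[d_i]=\{1,\dots,d_i\}$, $A=\prod_j A_j$, $A_{-i}=\prod_{j\ne i}A_j$, and loss function $\ell_i:A\to[0,1]$. $\Delta_d=\{x\in\mathbb R_{\ge0}^d:\sum_a x_a=1\}$. For mixed strategies $x_j\in\Delta_{d_j}$, the expected loss vector is $\ell_i(x_{-i})\in[0,1]^{d_i}$ with $[\ell_i(x_{-i})]_{a_i}=\sum_{a_{-i}\in A_{-i}}\ell_i(a_i,a_{-i})\prod_{j\ne i}x_{j,a_j}$. Optimistic Hedge self-play with step size $\eta>0$. For every player $i$: $x_i^1$ is uniform on $A_i$, $\ell_i^0=0\in\mathbb R^{d_i}$, and for every $t\ge1$, $\ell_i^t=\ell_i(x_{-i}^t)$ and $$x_{i,a}^{t+1}=\frac{x_{i,a}^t\exp\{-\eta(2\ell_{i,a}^t-\ell_{i,a}^{t-1})\}}{\sum_{b\in A_i}x_{i,b}^t\exp\{-\eta(2\ell_{i,b}^t-\ell_{i,b}^{t-1})\}},\qquad a\in A_i.$$ External regret: $\mathrm{Reg}_i(T)=\sum_{t=1}^T\langle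 x_i^t,\ell_i^t\rangle-\min_{a\in A_i}\sum_{t=1}^T\ell_{i,a}^t$. "Universal constant" means an absolute constant, independent of $n$, the $d_j$, the losses, the player and $T$. *)

theory Defs
  imports "HOL-Analysis.Analysis" "HOL-Library.FuncSet"
begin

text \<open>
  Players are \<open>1, \<dots>, n\<close>; player \<open>i\<close> has the actions \<open>1, \<dots>, d i\<close>. A profile of actions is an
  extensional function on its set of players, and \<open>l i a\<close> is the loss of player \<open>i\<close> at the profile
  \<open>a\<close>. A mixed strategy profile \<open>x\<close> gives player \<open>i\<close>'s action \<open>a\<close> the probability \<open>x i a\<close>.
\<close>

definition actions :: "(nat \<Rightarrow> nat) \<Rightarrow> nat \<Rightarrow> nat set" where
  "actions d i = {1..d i}"

definition profiles :: "(nat \<Rightarrow> nat) \<Rightarrow> nat set \<Rightarrow> (nat \<Rightarrow> nat) set" where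
  "profiles d P = (\<Pi>\<^sub>E j\<in>P. actions d j)"

definition game :: "nat \<Rightarrow> (nat \<Rightarrow> nat) \<Rightarrow> (nat \<Rightarrow> (nat \<Rightarrow> nat) \<Rightarrow> real) \<Rightarrow> bool" where
  "game n d l \<longleftrightarrow> n \<ge> 1 \<and> (\<forall>i\<in>{1..n}. d i \<ge> 1) \<and>
     (\<forall>i\<in>{1..n}. \<forall>a\<in>profiles d {1..n}. l i a \<in> {0..1})"

text \<open>
  For \<open>b\<close> in \<open>profiles d ({1..n} - {i})\<close>, the update \<open>b(i := a)\<close> is the profile \<open>(a, b)\<close> in
  \<open>profiles d {1..n}\<close>.
\<close>

definition expected_loss ::
  "nat \<Rightarrow> (nat \<Rightarrow> nat) \<Rightarrow> (nat \<Rightarrow> (nat \<Rightarrow> nat) \<Rightarrow> real) \<Rightarrow> (nat \<Rightarrow> nat \<Rightarrow> real) \<Rightarrow> nat \<Rightarrow> nat \<Rightarrow> real"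
where
  "expected_loss n d l x i a =
     (\<Sum>b\<in>profiles d ({1..n} - {i}). l i (b(i := a)) * (\<Prod>j\<in>{1..n} - {i}. x j (b j)))"

text \<open>
  Optimistic Hedge self-play with step size \<open>\<eta>\<close>: \<open>oh_strategy n d l \<eta> t i a\<close> is \<open>x\<^sub>i\<^sub>,\<^sub>a\<close> and
  \<open>oh_loss n d l \<eta> t i a\<close> is player \<open>i\<close>'s loss for \<open>a\<close> in round \<open>t\<close>. Rounds start at \<open>1\<close>: the loss in
  round \<open>0\<close> is zero by convention, and the strategy in round \<open>0\<close> is a dummy value that is never used.
\<close>

fun oh_strategy ::
  "nat \<Rightarrow> (nat \<Rightarrow> nat) \<Rightarrow> (nat \<Rightarrow> (nat \<Rightarrow> nat) \<Rightarrow> real) \<Rightarrow> real \<Rightarrow> nat \<Rightarrow> nat \<Rightarrow> nat \<Rightarrow> real"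
and oh_loss ::
  "nat \<Rightarrow> (nat \<Rightarrow> nat) \<Rightarrow> (nat \<Rightarrow> (nat \<Rightarrow> nat) \<Rightarrow> real) \<Rightarrow> real \<Rightarrow> nat \<Rightarrow> nat \<Rightarrow> nat \<Rightarrow> real"
where
  "oh_strategy n d l \<eta> 0 = (\<lambda>i a. 0)"
| "oh_strategy n d l \<eta> (Suc 0) = (\<lambda>i a. 1 / real (d i))"
| "oh_strategy n d l \<eta> (Suc (Suc t)) = (\<lambda>i a.
     oh_strategy n d l \<eta> (Suc t) i a *
       exp (- \<eta> * (2 * oh_loss n d l \<eta> (Suc t) i a - oh_loss n d l \<eta> t i a)) /
     (\<Sum>b\<in>actions d i. oh_strategy n d l \<eta> (Suc t) i b *
       exp (- \<eta> * (2 * oh_loss n d l \<eta> (Suc t) i b - oh_loss n d l \<eta> t i b))))"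
| "oh_loss n d l \<eta> 0 = (\<lambda>i a. 0)"
| "oh_loss n d l \<eta> (Suc t) = expected_loss n d l (oh_strategy n d l \<eta> (Suc t))"

definition oh_regret ::
  "nat \<Rightarrow> (nat \<Rightarrow> nat) \<Rightarrow> (nat \<Rightarrow> (nat \<Rightarrow> nat) \<Rightarrow> real) \<Rightarrow> real \<Rightarrow> nat \<Rightarrow> nat \<Rightarrow> real"
where
  "oh_regret n d l \<eta> i T =
     (\<Sum>t=1..T. \<Sum>a\<in>actions d i. oh_strategy n d l \<eta> t i a * oh_loss n d l \<eta> t i a)
     - Min ((\<lambda>a. \<Sum>t=1..T. oh_loss n d l \<eta> t i a) ` actions d i)"

end

theory Submission
  imports Defs
begin

text \<open>
  By induction on \<open>h\<close>, the \<open>h\<close>-th forward differences of the loss sequences are at most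
  \<open>(C * h * \<eta> * \<surd>n) ^ h\<close>: differences of the logits are \<open>\<eta>\<close> times lower-order differences of the
  losses, softmax preserves the bounds, and the product over the other players costs only \<open>\<surd>n\<close> by
  orthogonality. With \<open>\<eta> = c / (\<surd>n * ln (T + 2))\<close> this is exponentially small in \<open>h\<close> up to
  \<open>h = H \<approx> ln (T + 2)\<close>. Since the sums over the rounds of the variances of the \<open>h\<close>-th differences are
  nearly log-convex in \<open>h\<close>, smallness at \<open>h = H\<close> forces the sum of the variances of the first
  differences to be at most \<open>1 / 8\<close> of the sum of the variances of the losses, up to \<open>O(H)\<close>. The
  second-order regret bound of Optimistic Hedge, \<open>ln d / \<eta>\<close> plus \<open>\<eta>\<close> times exactly this gap, then
  gives the claim.
\<close>

section \<open>Finite differences\<close>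

text \<open>The bounds must not depend on the numbers of actions, and probabilities may become
  arbitrarily small. So strategies are measured relatively: around a base round \<open>t\<close>,
  every later one is written as \<open>X t j b * (1 + f j b s)\<close>. The \<open>f\<close> are
  small for any number of actions, and they have mean zero under \<open>X t j\<close>, which is what
  orthogonality needs. If they are of size \<open>M\<close>, the second moment of the product over
  the players is of the form \<open>(1 + O(M\<^sup>2)) ^ n\<close>, bounded as soon as
  \<open>M\<close> is of order \<open>1 / \<surd>n\<close>; adding up the contributions of the
  players one by one would demand \<open>1 / n\<close>. A window of \<open>H\<close> rounds can move
  the logits by \<open>3 * \<eta> * H\<close>, so \<open>\<eta> * H\<close> has to be of order
  \<open>1 / \<surd>n\<close>, and \<open>H\<close> of order \<open>ln (T + 2)\<close> lets
  geometric decay in \<open>H\<close> beat the number of rounds. This is the origin of the step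
  size. The 1 / 8 comes from the regret bound, where the variance of the losses enters through a
  lower bound on a log-moment generating function.\<close>

primrec fdiff :: "nat \<Rightarrow> (nat \<Rightarrow> real) \<Rightarrow> nat \<Rightarrow> real" where
  "fdiff 0 f t = f t"
| "fdiff (Suc k) f t = fdiff k f (Suc t) - fdiff k f t"

lemma fdiff_sum: "fdiff k (\<lambda>s. \<Sum>i\<in>I. f i s) t = (\<Sum>i\<in>I. fdiff k (f i) t)"
  by (induction k arbitrary: t) (simp_all add: sum_subtractf)

lemma fdiff_cmult: "fdiff k (\<lambda>s. c * f s) t = c * fdiff k f t"
  by (induction k arbitrary: t) (simp_all add: algebra_simps)

lemma fdiff_add: "fdiff k (\<lambda>s. f s + g s) t = fdiff k f t + fdiff k g t"
  by (induction k arbitrary: t) simp_all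

lemma fdiff_zero [simp]: "fdiff k (\<lambda>s. 0) t = 0"
  by (induction k arbitrary: t) simp_all

lemma fdiff_const: "k > 0 \<Longrightarrow> fdiff k (\<lambda>s. c) t = 0"
  by (induction k arbitrary: t) (auto, metis fdiff.simps(1) neq0_conv)

lemma fdiff_Suc': "fdiff (Suc k) f t = fdiff k (\<lambda>s. f (Suc s) - f s) t"
  by (induction k arbitrary: t) simp_all

lemma fdiff_cong: "(\<And>s. t \<le> s \<Longrightarrow> s \<le> t + k \<Longrightarrow> f s = g s) \<Longrightarrow> fdiff k f t = fdiff k g t"
proof (induction k arbitrary: t)
  case (Suc k)
  have "fdiff k f (Suc t) = fdiff k g (Suc t)" "fdiff k f t = fdiff k g t"
    by (rule Suc.IH; simp add: Suc.prems)+
  then show ?case by simp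
qed simp

lemma fdiff_tendsto:
  "(\<And>s. t \<le> s \<Longrightarrow> s \<le> t + k \<Longrightarrow> (\<lambda>m. F m s) \<longlonglongrightarrow> f s) \<Longrightarrow>
    (\<lambda>m. fdiff k (F m) t) \<longlonglongrightarrow> fdiff k f t"
proof (induction k arbitrary: t)
  case (Suc k)
  have "(\<lambda>m. fdiff k (F m) (Suc t)) \<longlonglongrightarrow> fdiff k f (Suc t)"
       "(\<lambda>m. fdiff k (F m) t) \<longlonglongrightarrow> fdiff k f t"
    by (rule Suc.IH; simp add: Suc.prems)+
  then show ?case by (simp add: tendsto_diff)
qed simp

lemma sum_pascal:
  fixes G :: "nat \<Rightarrow> real"
  shows "(\<Sum>k\<le>Suc h. real (Suc h choose k) * G k) =
     (\<Sum>k\<le>h. real (h choose k) * G k) + (\<Sum>k\<le>h. real (h choose k) * G (Suc k))"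
proof -
  have "(\<Sum>k\<le>Suc h. real (Suc h choose k) * G k)
      = G 0 + (\<Sum>k\<le>h. real (Suc h choose Suc k) * G (Suc k))"
    by (subst sum.atMost_Suc_shift) simp
  also have "\<dots> = G 0 + (\<Sum>k\<le>h. real (h choose Suc k) * G (Suc k))
      + (\<Sum>k\<le>h. real (h choose k) * G (Suc k))"
    by (simp add: algebra_simps sum.distrib)
  also have "G 0 + (\<Sum>k\<le>h. real (h choose Suc k) * G (Suc k)) = (\<Sum>k\<le>Suc h. real (h choose k) * G k)"
    by (subst sum.atMost_Suc_shift) simp
  also have "\<dots> = (\<Sum>k\<le>h. real (h choose k) * G k)"
    by (simp add: binomial_eq_0)
  finally show ?thesis .
qed

text \<open>Discrete Leibniz rule. The second factor is differenced at the shifted time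
  \<open>t + k\<close>, which is why \<open>smooth\<close> below controls every starting point in a
  window and not \<open>t\<close> alone.\<close>

lemma fdiff_mult:
  "fdiff h (\<lambda>s. f s * g s) t =
     (\<Sum>k\<le>h. real (h choose k) * (fdiff k f t * fdiff (h - k) g (t + k)))"
proof (induction h arbitrary: f g t)
  case (Suc h)
  have "fdiff (Suc h) (\<lambda>s. f s * g s) t =
      fdiff h (\<lambda>s. f s * (g (Suc s) - g s) + (f (Suc s) - f s) * g (Suc s)) t"
    unfolding fdiff_Suc' by (rule fdiff_cong) (simp add: algebra_simps)
  also have "\<dots> = (\<Sum>k\<le>h. real (h choose k) * (fdiff k f t * fdiff (Suc h - k) g (t + k)))
    + (\<Sum>k\<le>h. real (h choose k) * (fdiff (Suc k) f t * fdiff (Suc h - Suc k) g (t + Suc k)))"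
  proof -
    have sh: "fdiff k (\<lambda>s. g (Suc s)) t = fdiff k g (Suc t)" for k t
      by (induction k arbitrary: t) simp_all
    show ?thesis
      unfolding fdiff_add Suc.IH
      by (simp only: fdiff_Suc'[symmetric] sh)
         (intro arg_cong2[where f="(+)"] sum.cong refl; simp add: Suc_diff_le fdiff_Suc'[symmetric])
  qed
  also have "\<dots> = (\<Sum>k\<le>Suc h. real (Suc h choose k) * (fdiff k f t * fdiff (Suc h - k) g (t + k)))"
    by (rule sum_pascal[symmetric])
  finally show ?case .
qed simp

text \<open>
  The factor \<open>1 / (k + 1)\<^sup>2\<close> makes \<open>weight\<close> submultiplicative, up to a constant, under binomial
  convolution, so that \<open>smooth\<close> behaves like a Banach algebra norm. An induction on the order of the
  difference with the plain weight \<open>k! A ^ k\<close> would not close.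
\<close>

definition weight :: "real \<Rightarrow> nat \<Rightarrow> real" where
  "weight A k = fact k * A ^ k / (real k + 1)\<^sup>2"

lemma weight_nonneg: "A \<ge> 0 \<Longrightarrow> weight A k \<ge> 0"
  by (simp add: weight_def)

lemma weight_0 [simp]: "weight A 0 = 1"
  by (simp add: weight_def)

lemma sum_inverse_squares_le: "(\<Sum>k\<le>h. 1 / (real k + 1)\<^sup>2) \<le> 2 - 1 / (real h + 1)"
proof (induction h)
  case (Suc h)
  have "1 / (real h + 2)\<^sup>2 \<le> 1 / ((real h + 1) * (real h + 2))"
    by (rule divide_left_mono) (auto simp: power2_eq_square)
  also have "\<dots> = 1 / (real h + 1) - 1 / (real h + 2)"
    by (simp add: field_simps)
  finally show ?case using Suc by (simp add: add.commute)
qed simp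

text \<open>Factorials and powers cancel against the binomial coefficient; what remains is the
  sequence \<open>1 / (k + 1)\<^sup>2\<close> convolved with itself. By partial fractions a product
  of two reciprocals is their sum divided by \<open>h + 2\<close>; squaring leaves two copies of a
  series bounded by 2, hence \<open>8 = 2 * (2 + 2)\<close>.\<close>

lemma weight_convolution:
  assumes "A \<ge> 0"
  shows "(\<Sum>k\<le>h. real (h choose k) * (weight A k * weight A (h - k))) \<le> 8 * weight A h"
proof -
  let ?r = "\<lambda>k::nat. 1 / (real k + 1)"
  have "real (h choose k) * (weight A k * weight A (h - k))
      \<le> fact h * A ^ h * (2 * ((?r k)\<^sup>2 + (?r (h - k))\<^sup>2) / (real h + 1)\<^sup>2)" if k: "k \<le> h" for k
  proof -
    have b: "real (h choose k) * fact k * fact (h - k) = fact h"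
      using binomial_fact_lemma[OF k] by (metis (no_types) mult.assoc mult.commute of_nat_fact of_nat_mult)
    have pw: "A ^ k * A ^ (h - k) = A ^ h"
      using k by (simp flip: power_add)
    have "real (h choose k) * (weight A k * weight A (h - k))
       = (real (h choose k) * fact k * fact (h - k)) * (A ^ k * A ^ (h - k)) * (?r k * ?r (h - k))\<^sup>2"
      by (simp add: weight_def power_mult_distrib power_divide)
    also have "\<dots> = fact h * A ^ h * (?r k * ?r (h - k))\<^sup>2"
      by (simp only: b pw)
    also have "(?r k * ?r (h - k))\<^sup>2 \<le> 2 * ((?r k)\<^sup>2 + (?r (h - k))\<^sup>2) / (real h + 1)\<^sup>2"
    proof -
      have "?r k * ?r (h - k) = (?r k + ?r (h - k)) / (real h + 2)"
      proof -
        have recip: "x * y = (x + y) / z" if "z = 1 / x + 1 / y" "x > 0" "y > 0" for x y z :: real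
        proof -
          have "z > 0" unfolding that(1) using that(2,3) by (intro add_pos_pos) auto
          have "x + y = x * y * z" unfolding that(1) using that(2,3) by (simp add: field_simps)
          with \<open>z > 0\<close> show ?thesis by (metis nonzero_mult_div_cancel_right less_irrefl)
        qed
        show ?thesis by (rule recip) (use k in \<open>simp_all add: of_nat_diff\<close>)
      qed
      also have "\<dots> \<le> (?r k + ?r (h - k)) / (real h + 1)"
        by (rule divide_left_mono) auto
      finally have "(?r k * ?r (h - k))\<^sup>2 \<le> ((?r k + ?r (h - k)) / (real h + 1))\<^sup>2"
        by (rule power_mono) auto
      also have "\<dots> = (?r k + ?r (h - k))\<^sup>2 / (real h + 1)\<^sup>2"
        by (simp add: power_divide)
      also have "\<dots> \<le> 2 * ((?r k)\<^sup>2 + (?r (h - k))\<^sup>2) / (real h + 1)\<^sup>2"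
      proof (rule divide_right_mono)
        show "(?r k + ?r (h - k))\<^sup>2 \<le> 2 * ((?r k)\<^sup>2 + (?r (h - k))\<^sup>2)"
          using sum_squares_bound[of "?r k" "?r (h-k)"] unfolding power2_sum distrib_left by linarith
      qed simp
      finally show ?thesis .
    qed
    finally show ?thesis using assms by (simp add: mult_left_mono)
  qed
  then have "(\<Sum>k\<le>h. real (h choose k) * (weight A k * weight A (h - k)))
      \<le> (\<Sum>k\<le>h. fact h * A ^ h * (2 * ((?r k)\<^sup>2 + (?r (h - k))\<^sup>2) / (real h + 1)\<^sup>2))"
    by (intro sum_mono) simp
  also have "\<dots> = fact h * A ^ h * (2 * ((\<Sum>k\<le>h. (?r k)\<^sup>2) + (\<Sum>k\<le>h. (?r (h - k))\<^sup>2)) / (real h + 1)\<^sup>2)"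
    by (simp only: sum_distrib_left[symmetric] sum.distrib sum_divide_distrib[symmetric])
  also have "(\<Sum>k\<le>h. (?r (h - k))\<^sup>2) = (\<Sum>k\<le>h. (?r k)\<^sup>2)"
    by (rule sum.reindex_bij_witness[of _ "\<lambda>k. h - k" "\<lambda>k. h - k"]) auto
  also have "fact h * A ^ h * (2 * ((\<Sum>k\<le>h. (?r k)\<^sup>2) + (\<Sum>k\<le>h. (?r k)\<^sup>2)) / (real h + 1)\<^sup>2)
      \<le> fact h * A ^ h * (2 * (2 + 2) / (real h + 1)\<^sup>2)"
  proof -
    have "(\<Sum>k\<le>h. (?r k)\<^sup>2) \<le> 2"
      using sum_inverse_squares_le[of h] by (simp add: power_divide) (smt (verit) divide_nonneg_nonneg of_nat_0_le_iff)
    then show ?thesis using assms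
      by (intro mult_left_mono divide_right_mono) auto
  qed
  also have "\<dots> = 8 * weight A h" by (simp add: weight_def)
  finally show ?thesis .
qed

text \<open>A difference of order \<open>k\<close> at \<open>s\<close> reads \<open>f\<close> on the
  rounds \<open>s, ..., s + k\<close>, so this is a condition on the rounds
  \<open>t, ..., t + h\<close> only. The locality matters: in self-play, bounds are available only
  for limited orders and late rounds.\<close>

definition smooth :: "real \<Rightarrow> nat \<Rightarrow> nat \<Rightarrow> real \<Rightarrow> (nat \<Rightarrow> real) \<Rightarrow> bool" where
  "smooth A t h M f \<longleftrightarrow> (\<forall>k s. t \<le> s \<longrightarrow> s + k \<le> t + h \<longrightarrow> \<bar>fdiff k f s\<bar> \<le> M * weight A k)"

lemma smoothD: "smooth A t h M f \<Longrightarrow> t \<le> s \<Longrightarrow> s + k \<le> t + h \<Longrightarrow> \<bar>fdiff k f s\<bar> \<le> M * weight A k"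
  by (simp add: smooth_def)

lemma smooth_abs_le: "smooth A t h M f \<Longrightarrow> t \<le> s \<Longrightarrow> s \<le> t + h \<Longrightarrow> \<bar>f s\<bar> \<le> M"
  using smoothD[of A t h M f s 0] by simp

lemma smooth_nonneg: "smooth A t h M f \<Longrightarrow> M \<ge> 0"
  using smooth_abs_le[of A t h M f t] by simp

lemma smooth_mono: "A \<ge> 0 \<Longrightarrow> smooth A t h M f \<Longrightarrow> M \<le> N \<Longrightarrow> smooth A t h N f"
  unfolding smooth_def by (meson mult_right_mono order_trans weight_nonneg)

lemma smooth_one: "A \<ge> 0 \<Longrightarrow> smooth A t h 1 (\<lambda>s. 1)"
  unfolding smooth_def
proof (intro allI impI)
  fix k s assume "A \<ge> 0"
  then show "\<bar>fdiff k (\<lambda>s. 1) s\<bar> \<le> 1 * weight A k"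
    by (cases k) (auto simp: fdiff_const weight_nonneg simp del: fdiff.simps(2))
qed

lemma smooth_zero: "A \<ge> 0 \<Longrightarrow> smooth A t h 0 (\<lambda>s. 0)"
  by (simp add: smooth_def)

lemma smooth_add: "smooth A t h M f \<Longrightarrow> smooth A t h N g \<Longrightarrow> smooth A t h (M + N) (\<lambda>s. f s + g s)"
  unfolding smooth_def fdiff_add distrib_right
  by (meson abs_triangle_ineq add_mono order_trans)

lemma smooth_cmult: "smooth A t h M f \<Longrightarrow> smooth A t h (\<bar>c\<bar> * M) (\<lambda>s. c * f s)"
  unfolding smooth_def fdiff_cmult abs_mult mult.assoc
  by (meson abs_ge_zero mult_left_mono)

lemma smooth_sum:
  assumes "A \<ge> 0" "\<And>i. i \<in> I \<Longrightarrow> smooth A t h (M i) (f i)"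
  shows "smooth A t h (\<Sum>i\<in>I. M i) (\<lambda>s. \<Sum>i\<in>I. f i s)"
  using assms(2)
proof (induction I rule: infinite_finite_induct)
  case (insert x F)
  then show ?case using smooth_add[of A t h "M x" "f x" "sum M F"] by simp
qed (simp_all add: smooth_zero assms(1))

lemma smooth_mult:
  assumes "A \<ge> 0" "smooth A t h M f" "smooth A t h N g"
  shows "smooth A t h (8 * M * N) (\<lambda>s. f s * g s)"
  unfolding smooth_def
proof (intro allI impI)
  fix k s assume s: "t \<le> s" "s + k \<le> t + h"
  have MN: "M \<ge> 0" "N \<ge> 0" using assms smooth_nonneg by blast+
  have "\<bar>fdiff k (\<lambda>s. f s * g s) s\<bar> \<le>
      (\<Sum>j\<le>k. \<bar>real (k choose j) * (fdiff j f s * fdiff (k - j) g (s + j))\<bar>)"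
    unfolding fdiff_mult by (rule sum_abs)
  also have "\<dots> \<le> (\<Sum>j\<le>k. real (k choose j) * ((M * weight A j) * (N * weight A (k - j))))"
  proof (rule sum_mono)
    fix j assume "j \<in> {..k}"
    then have "\<bar>fdiff j f s\<bar> \<le> M * weight A j" "\<bar>fdiff (k - j) g (s + j)\<bar> \<le> N * weight A (k - j)"
      using s by (auto intro!: smoothD[OF assms(2)] smoothD[OF assms(3)])
    then have "\<bar>fdiff j f s\<bar> * \<bar>fdiff (k - j) g (s + j)\<bar> \<le> (M * weight A j) * (N * weight A (k - j))"
      using MN assms(1) by (intro mult_mono) (auto simp: weight_nonneg)
    then show "\<bar>real (k choose j) * (fdiff j f s * fdiff (k - j) g (s + j))\<bar>
       \<le> real (k choose j) * ((M * weight A j) * (N * weight A (k - j)))"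
      unfolding abs_mult by (simp add: mult_left_mono)
  qed
  also have "\<dots> = M * N * (\<Sum>j\<le>k. real (k choose j) * (weight A j * weight A (k - j)))"
    by (simp add: sum_distrib_left algebra_simps)
  also have "\<dots> \<le> M * N * (8 * weight A k)"
    using MN by (intro mult_left_mono weight_convolution assms) auto
  finally show "\<bar>fdiff k (\<lambda>s. f s * g s) s\<bar> \<le> 8 * M * N * weight A k" by (simp add: algebra_simps)
qed

lemma smooth_prod:
  assumes "A \<ge> 0" "finite S" "\<And>i. i \<in> S \<Longrightarrow> smooth A t h N (f i)"
  shows "smooth A t h ((8 * N) ^ card S) (\<lambda>s. \<Prod>i\<in>S. f i s)"
  using assms(2,3)
proof (induction S)
  case (insert x F)
  then show ?case
    using smooth_mult[OF assms(1), of t h N "f x" "(8*N)^card F" "\<lambda>s. \<Prod>i\<in>F. f i s"] by simp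
qed (simp add: smooth_one assms(1))

section \<open>Power series and softmax of smooth sequences\<close>

lemma smooth_power:
  assumes "A \<ge> 0" "smooth A t h M f"
  shows "smooth A t h (M * (8 * M) ^ m) (\<lambda>s. f s ^ Suc m)"
proof (induction m)
  case (Suc m)
  then show ?case using smooth_mult[OF assms Suc] by (simp add: algebra_simps)
qed (simp add: assms)

text \<open>A series without constant term keeps a factor \<open>M\<close>, so smallness survives.
  The condition on \<open>M\<close> makes the ratio \<open>8 * M\<close> from
  \<open>smooth_power\<close> at most 1 / 2, and the geometric series gives the factor 2.
  Differences are finite combinations of values, so the bound passes from the partial sums to the
  limit.\<close>

lemma smooth_power_series:
  assumes A: "A \<ge> 0" and f: "smooth A t h M f" and M: "16 * M \<le> 1"
    and c: "\<And>m. \<bar>c m\<bar> \<le> 1"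
    and g: "\<And>s. t \<le> s \<Longrightarrow> s \<le> t + h \<Longrightarrow> (\<lambda>m. c m * f s ^ Suc m) sums g s"
  shows "smooth A t h (2 * M) g"
proof -
  have M0: "M \<ge> 0" using smooth_nonneg[OF f] .
  have part: "smooth A t h (2 * M) (\<lambda>s. \<Sum>m<n. c m * f s ^ Suc m)" for n
  proof -
    have "smooth A t h (\<Sum>m<n. \<bar>c m\<bar> * (M * (8 * M) ^ m)) (\<lambda>s. \<Sum>m<n. c m * f s ^ Suc m)"
      by (intro smooth_sum A smooth_cmult smooth_power f)
    moreover have "(\<Sum>m<n. \<bar>c m\<bar> * (M * (8 * M) ^ m)) \<le> 2 * M"
    proof -
      have "(\<Sum>m<n. \<bar>c m\<bar> * (M * (8 * M) ^ m)) \<le> (\<Sum>m<n. 1 * (M * (1/2) ^ m))"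
        using M M0 c by (intro sum_mono mult_mono power_mono) auto
      also have "\<dots> = M * (\<Sum>m<n. (1/2) ^ m)" by (simp add: sum_distrib_left)
      also have "\<dots> \<le> M * 2"
        using M0 by (intro mult_left_mono) (simp_all add: geometric_sum)
      finally show ?thesis by simp
    qed
    ultimately show ?thesis using smooth_mono A by blast
  qed
  show ?thesis unfolding smooth_def
  proof (intro allI impI)
    fix k s assume s: "t \<le> s" "s + k \<le> t + h"
    have "(\<lambda>n. fdiff k (\<lambda>s. \<Sum>m<n. c m * f s ^ Suc m) s) \<longlonglongrightarrow> fdiff k g s"
      using g s by (intro fdiff_tendsto) (auto simp: sums_def)
    then have "(\<lambda>n. \<bar>fdiff k (\<lambda>s. \<Sum>m<n. c m * f s ^ Suc m) s\<bar>) \<longlonglongrightarrow> \<bar>fdiff k g s\<bar>"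
      by (rule tendsto_rabs)
    then show "\<bar>fdiff k g s\<bar> \<le> 2 * M * weight A k"
      by (rule LIMSEQ_le_const2) (use smoothD[OF part s] in blast)
  qed
qed

lemma smooth_exp:
  assumes "A \<ge> 0" "smooth A t h M f" "16 * M \<le> 1"
  shows "smooth A t h (2 * M) (\<lambda>s. exp (f s) - 1)"
proof (rule smooth_power_series[OF assms, where c = "\<lambda>m. 1 / fact (Suc m)"])
  show "\<bar>1 / fact (Suc m)\<bar> \<le> (1::real)" for m
    using fact_ge_1[of "Suc m", where 'a=real] by (simp del: fact_Suc)
  fix s
  have "(\<lambda>m. f s ^ m /\<^sub>R fact m) sums exp (f s)" by (rule exp_converges)
  from sums_split_initial_segment[OF this, of 1]
  show "(\<lambda>m. 1 / fact (Suc m) * f s ^ Suc m) sums (exp (f s) - 1)"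
    by (simp add: field_simps)
qed

lemma smooth_inverse:
  assumes "A \<ge> 0" "smooth A t h M f" "16 * M \<le> 1"
  shows "smooth A t h (2 * M) (\<lambda>s. 1 / (1 + f s) - 1)"
proof (rule smooth_power_series[OF assms, where c = "\<lambda>m. (-1) ^ Suc m"])
  fix s assume "t \<le> s" "s \<le> t + h"
  then have "\<bar>f s\<bar> \<le> M" using smooth_abs_le[OF assms(2)] by blast
  then have "norm (- f s) < 1" using assms(3) by simp
  then have "(\<lambda>m. (- f s) ^ m) sums (1 / (1 - (- f s)))" by (rule geometric_sums)
  from sums_split_initial_segment[OF this, of 1]
  have "(\<lambda>m. (- f s) ^ Suc m) sums (1 / (1 + f s) - 1)" by simp
  then show "(\<lambda>m. (-1) ^ Suc m * f s ^ Suc m) sums (1 / (1 + f s) - 1)"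
    by (simp only: power_mult_distrib[symmetric]) simp
qed (simp add: power_abs)

text \<open>Since \<open>p\<close> sums to 1, the denominator is 1 plus a \<open>p\<close>-average
  of the terms \<open>exp (u b s) - 1\<close>. Averaging costs nothing, so the bound does not see
  the number of actions.\<close>

lemma smooth_softmax_ratio:
  assumes A: "A \<ge> 0" and M: "32 * M \<le> 1"
    and p: "\<And>b. b \<in> B \<Longrightarrow> p b \<ge> 0" "sum p B = 1"
    and u: "\<And>b. b \<in> B \<Longrightarrow> smooth A t h M (u b)" and a: "a \<in> B"
  shows "smooth A t h (10 * M) (\<lambda>s. exp (u a s) / (\<Sum>b\<in>B. p b * exp (u b s)) - 1)"
proof -
  have M0: "M \<ge> 0" using smooth_nonneg[OF u[OF a]] .
  define P where "P b s = exp (u b s) - 1" for b s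
  define v where "v s = (\<Sum>b\<in>B. p b * P b s)" for s
  have P: "smooth A t h (2 * M) (P b)" if "b \<in> B" for b
    unfolding P_def using smooth_exp[OF A u[OF that]] M by simp
  have "smooth A t h (\<Sum>b\<in>B. \<bar>p b\<bar> * (2 * M)) v"
    unfolding v_def by (intro smooth_sum smooth_cmult A P)
  moreover have "(\<Sum>b\<in>B. \<bar>p b\<bar> * (2 * M)) = (\<Sum>b\<in>B. p b) * (2 * M)"
    unfolding sum_distrib_right by (intro sum.cong refl) (simp add: p)
  ultimately have v: "smooth A t h (2 * M) v" using p by simp
  have q: "smooth A t h (4 * M) (\<lambda>s. 1 / (1 + v s) - 1)"
    using smooth_inverse[OF A v] M by simp
  have eq: "exp (u a s) / (\<Sum>b\<in>B. p b * exp (u b s)) - 1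
      = P a s + (1 / (1 + v s) - 1) + P a s * (1 / (1 + v s) - 1)" for s
  proof -
    have "(\<Sum>b\<in>B. p b * exp (u b s)) = 1 + v s"
      unfolding v_def P_def using p by (simp add: algebra_simps sum_subtractf)
    then have "exp (u a s) / (\<Sum>b\<in>B. p b * exp (u b s)) = (1 + P a s) * (1 / (1 + v s))"
      by (simp add: P_def)
    then show ?thesis by (simp add: algebra_simps add_divide_distrib)
  qed
  have "smooth A t h (2 * M + 4 * M + 8 * (2 * M) * (4 * M))
     (\<lambda>s. P a s + (1 / (1 + v s) - 1) + P a s * (1 / (1 + v s) - 1))"
    by (intro smooth_add smooth_mult A P a q)
  moreover have "2 * M + 4 * M + 8 * (2 * M) * (4 * M) \<le> 10 * M"
  proof -
    have "M * (32 * M) \<le> M * 1" using M M0 by (intro mult_left_mono)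
    then show ?thesis using M0 by simp
  qed
  ultimately show ?thesis unfolding eq using smooth_mono A by blast
qed

section \<open>Product distributions\<close>

lemma sum_PiE_prod:
  fixes g :: "'a \<Rightarrow> 'b \<Rightarrow> real"
  assumes "finite J" "\<And>j. j \<in> J \<Longrightarrow> finite (B j)"
  shows "(\<Sum>b\<in>PiE J B. \<Prod>j\<in>J. g j (b j)) = (\<Prod>j\<in>J. \<Sum>c\<in>B j. g j c)"
  by (rule prod_sum_PiE[symmetric]) (use assms in auto)

text \<open>
  The source of the factor \<open>\<surd>n\<close> instead of \<open>n\<close>: the likelihood ratio \<open>\<Prod>j. (1 + f\<^sub>j)\<close> of two product
  distributions is a sum of products over sets of players, which are pairwise orthogonal because each
  \<open>f\<^sub>j\<close> has mean zero.
\<close>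

lemma sum_product_chaos_orthogonal:
  fixes p f g :: "'a \<Rightarrow> 'b \<Rightarrow> real"
  assumes J: "finite J" "\<And>j. j \<in> J \<Longrightarrow> finite (B j)"
    and f0: "\<And>j. j \<in> J \<Longrightarrow> (\<Sum>c\<in>B j. p j c * f j c) = 0"
    and g0: "\<And>j. j \<in> J \<Longrightarrow> (\<Sum>c\<in>B j. p j c * g j c) = 0"
    and S: "S \<subseteq> J" "S' \<subseteq> J" "S \<noteq> S'"
  shows "(\<Sum>b\<in>PiE J B. (\<Prod>j\<in>J. p j (b j)) * (\<Prod>j\<in>S. f j (b j)) * (\<Prod>j\<in>S'. g j (b j))) = 0"
proof -
  define G where "G j c = p j c * (if j \<in> S then f j c else 1) * (if j \<in> S' then g j c else 1)" for j c
  have "(\<Sum>b\<in>PiE J B. (\<Prod>j\<in>J. p j (b j)) * (\<Prod>j\<in>S. f j (b j)) * (\<Prod>j\<in>S'. g j (b j)))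
      = (\<Sum>b\<in>PiE J B. \<Prod>j\<in>J. G j (b j))"
  proof (rule sum.cong[OF refl])
    fix b
    have "(\<Prod>j\<in>S. f j (b j)) = (\<Prod>j\<in>J. if j \<in> S then f j (b j) else 1)"
      using prod.inter_restrict[OF J(1), of "\<lambda>j. f j (b j)" S] S(1) by (simp add: Int_absorb1)
    moreover have "(\<Prod>j\<in>S'. g j (b j)) = (\<Prod>j\<in>J. if j \<in> S' then g j (b j) else 1)"
      using prod.inter_restrict[OF J(1), of "\<lambda>j. g j (b j)" S'] S(2) by (simp add: Int_absorb1)
    ultimately show "(\<Prod>j\<in>J. p j (b j)) * (\<Prod>j\<in>S. f j (b j)) * (\<Prod>j\<in>S'. g j (b j))
        = (\<Prod>j\<in>J. G j (b j))"
      by (simp add: G_def prod.distrib)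
  qed
  also have "\<dots> = (\<Prod>j\<in>J. \<Sum>c\<in>B j. G j c)"
    by (rule sum_PiE_prod[OF J])
  also have "\<dots> = 0"
  proof -
    obtain j where j: "j \<in> J" "(j \<in> S) \<noteq> (j \<in> S')" using S by blast
    then have "(\<Sum>c\<in>B j. G j c) = 0"
      using f0[of j] g0[of j] unfolding G_def by (cases "j \<in> S") auto
    then show ?thesis using j(1) J(1) by (meson prod_zero)
  qed
  finally show ?thesis .
qed

text \<open>After expanding the product over subsets of \<open>J\<close> and squaring, only the
  diagonal terms survive. A set of size \<open>m\<close> contributes at most
  \<open>(8 * N) ^ (2 * m)\<close> times \<open>(weight A h)\<^sup>2\<close>, and the sum over all
  sets is again a binomial expansion.\<close>

lemma fdiff_product_second_moment:
  fixes p :: "'a \<Rightarrow> 'b \<Rightarrow> real"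
  assumes A: "A \<ge> 0" and J: "finite J" "\<And>j. j \<in> J \<Longrightarrow> finite (B j)"
    and p: "\<And>j c. j \<in> J \<Longrightarrow> c \<in> B j \<Longrightarrow> p j c \<ge> 0" "\<And>j. j \<in> J \<Longrightarrow> sum (p j) (B j) = 1"
    and f0: "\<And>j s. j \<in> J \<Longrightarrow> (\<Sum>c\<in>B j. p j c * f j c s) = 0"
    and f: "\<And>j c. j \<in> J \<Longrightarrow> c \<in> B j \<Longrightarrow> smooth A t h N (f j c)"
  shows "(\<Sum>b\<in>PiE J B. (\<Prod>j\<in>J. p j (b j)) * (fdiff h (\<lambda>s. \<Prod>j\<in>J. 1 + f j (b j) s) t)\<^sup>2)
     \<le> (weight A h)\<^sup>2 * (1 + (8 * N)\<^sup>2) ^ card J"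
proof -
  define \<mu> where "\<mu> b = (\<Prod>j\<in>J. p j (b j))" for b
  define g where "g S b = fdiff h (\<lambda>s. \<Prod>j\<in>S. f j (b j) s) t" for S b
  have \<mu>0: "\<mu> b \<ge> 0" if "b \<in> PiE J B" for b
    unfolding \<mu>_def using that p by (intro prod_nonneg) auto
  have \<mu>1: "sum \<mu> (PiE J B) = 1"
    unfolding \<mu>_def using sum_PiE_prod[OF J, where g = p] p by simp
  have expand: "fdiff h (\<lambda>s. \<Prod>j\<in>J. 1 + f j (b j) s) t = (\<Sum>S\<in>Pow J. g S b)" for b
  proof -
    have "(\<Prod>j\<in>J. 1 + f j (b j) s) = (\<Sum>S\<in>Pow J. \<Prod>j\<in>S. f j (b j) s)" for s
      using prod_add[OF J(1), of "\<lambda>j. f j (b j) s" "\<lambda>j. 1"] by (simp add: add.commute)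
    then show ?thesis unfolding g_def by (simp add: fdiff_sum)
  qed
  \<comment> \<open>The two differences run over separate times. Linearity of \<open>fdiff\<close>
    in each of them reduces the claim to orthogonality of products taken at unequal times, which is
    why \<open>sum_product_chaos_orthogonal\<close> allows two families.\<close>
  have orth: "(\<Sum>b\<in>PiE J B. \<mu> b * (g S b * g S' b)) = 0"
    if S: "S \<in> Pow J" "S' \<in> Pow J" "S \<noteq> S'" for S S'
  proof -
    have "(\<Sum>b\<in>PiE J B. \<mu> b * (g S b * g S' b)) = (\<Sum>b\<in>PiE J B. (\<mu> b * g S' b) * g S b)"
      by (simp add: ac_simps)
    also have "\<dots> = fdiff h (\<lambda>s. \<Sum>b\<in>PiE J B. (\<mu> b * g S' b) * (\<Prod>j\<in>S. f j (b j) s)) t"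
      unfolding fdiff_sum fdiff_cmult g_def ..
    also have "(\<lambda>s. \<Sum>b\<in>PiE J B. (\<mu> b * g S' b) * (\<Prod>j\<in>S. f j (b j) s)) =
        (\<lambda>s. \<Sum>b\<in>PiE J B. (\<mu> b * (\<Prod>j\<in>S. f j (b j) s)) * g S' b)"
      by (simp add: ac_simps)
    also have "\<dots> = (\<lambda>s. fdiff h (\<lambda>s'. \<Sum>b\<in>PiE J B. \<mu> b * (\<Prod>j\<in>S. f j (b j) s) * (\<Prod>j\<in>S'. f j (b j) s')) t)"
      unfolding fdiff_sum fdiff_cmult g_def ..
    also have "(\<lambda>s s'. \<Sum>b\<in>PiE J B. \<mu> b * (\<Prod>j\<in>S. f j (b j) s) * (\<Prod>j\<in>S'. f j (b j) s')) = (\<lambda>s s'. 0)"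
      unfolding \<mu>_def using S
      by (intro ext sum_product_chaos_orthogonal J f0) auto
    finally show ?thesis by simp
  qed
  have diag: "(\<Sum>b\<in>PiE J B. \<mu> b * (g S b)\<^sup>2) \<le> (weight A h)\<^sup>2 * ((8 * N)\<^sup>2) ^ card S"
    if S: "S \<in> Pow J" for S
  proof -
    have "(\<Sum>b\<in>PiE J B. \<mu> b * (g S b)\<^sup>2) \<le> (\<Sum>b\<in>PiE J B. \<mu> b * ((8 * N) ^ card S * weight A h)\<^sup>2)"
    proof (rule sum_mono)
      fix b assume b: "b \<in> PiE J B"
      have "smooth A t h ((8 * N) ^ card S) (\<lambda>s. \<Prod>j\<in>S. f j (b j) s)"
        using S b finite_subset[OF _ J(1)] by (intro smooth_prod A f) auto
      then have "\<bar>g S b\<bar> \<le> (8 * N) ^ card S * weight A h"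
        unfolding g_def by (rule smoothD) auto
      then have "(g S b)\<^sup>2 \<le> ((8 * N) ^ card S * weight A h)\<^sup>2"
        using power_mono[of "\<bar>g S b\<bar>" _ 2] by simp
      then show "\<mu> b * (g S b)\<^sup>2 \<le> \<mu> b * ((8 * N) ^ card S * weight A h)\<^sup>2"
        using \<mu>0[OF b] by (rule mult_left_mono)
    qed
    also have "\<dots> = (weight A h)\<^sup>2 * ((8 * N)\<^sup>2) ^ card S"
      unfolding sum_distrib_right[symmetric] \<mu>1
      unfolding power_mult_distrib[of "(8 * N) ^ card S"]
      by (simp only: power_mult[symmetric] mult.commute mult_1_right)
    finally show ?thesis .
  qed
  have "(\<Sum>b\<in>PiE J B. \<mu> b * (fdiff h (\<lambda>s. \<Prod>j\<in>J. 1 + f j (b j) s) t)\<^sup>2)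
     = (\<Sum>b\<in>PiE J B. \<Sum>S\<in>Pow J. \<Sum>S'\<in>Pow J. \<mu> b * (g S b * g S' b))"
    unfolding expand power2_eq_square sum_product unfolding sum_distrib_left ..
  also have "\<dots> = (\<Sum>S\<in>Pow J. \<Sum>S'\<in>Pow J. \<Sum>b\<in>PiE J B. \<mu> b * (g S b * g S' b))"
    by (subst sum.swap) (rule sum.cong[OF refl], rule sum.swap)
  also have "\<dots> = (\<Sum>S\<in>Pow J. \<Sum>S'\<in>Pow J. if S = S' then \<Sum>b\<in>PiE J B. \<mu> b * (g S b)\<^sup>2 else 0)"
    by (intro sum.cong refl) (auto simp: orth power2_eq_square)
  also have "\<dots> = (\<Sum>S\<in>Pow J. \<Sum>b\<in>PiE J B. \<mu> b * (g S b)\<^sup>2)"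
    using J(1) by simp
  also have "\<dots> \<le> (\<Sum>S\<in>Pow J. (weight A h)\<^sup>2 * ((8 * N)\<^sup>2) ^ card S)"
    by (intro sum_mono diag)
  also have "\<dots> = (weight A h)\<^sup>2 * (\<Sum>S\<in>Pow J. (\<Prod>j\<in>S. (8 * N)\<^sup>2) * (\<Prod>j\<in>J - S. 1))"
    by (simp add: sum_distrib_left)
  also have "\<dots> = (weight A h)\<^sup>2 * (1 + (8 * N)\<^sup>2) ^ card J"
    using prod_add[OF J(1), of "\<lambda>j. (8 * N)\<^sup>2" "\<lambda>j. 1"] by (simp add: add.commute)
  finally show ?thesis unfolding \<mu>_def .
qed

lemma weighted_abs_sum_le:
  fixes \<mu> G :: "'a \<Rightarrow> real"
  assumes "\<And>b. b \<in> I \<Longrightarrow> \<mu> b \<ge> 0" "sum \<mu> I = 1"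
    and "(\<Sum>b\<in>I. \<mu> b * (G b)\<^sup>2) \<le> r\<^sup>2" "r \<ge> 0"
  shows "(\<Sum>b\<in>I. \<mu> b * \<bar>G b\<bar>) \<le> r"
proof -
  have "(\<Sum>b\<in>I. \<mu> b * \<bar>G b\<bar>)\<^sup>2 = (\<Sum>b\<in>I. sqrt (\<mu> b) * (sqrt (\<mu> b) * \<bar>G b\<bar>))\<^sup>2"
    using assms(1) by (intro arg_cong[where f = "\<lambda>x. x\<^sup>2"] sum.cong refl) (simp flip: mult.assoc)
  also have "\<dots> \<le> (\<Sum>b\<in>I. (sqrt (\<mu> b))\<^sup>2) * (\<Sum>b\<in>I. (sqrt (\<mu> b) * \<bar>G b\<bar>)\<^sup>2)"
    by (rule Cauchy_Schwarz_ineq_sum)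
  also have "\<dots> = (\<Sum>b\<in>I. \<mu> b * (G b)\<^sup>2)"
  proof -
    have "(\<Sum>b\<in>I. (sqrt (\<mu> b))\<^sup>2) = 1" using assms(1,2) by simp
    moreover have "(\<Sum>b\<in>I. (sqrt (\<mu> b) * \<bar>G b\<bar>)\<^sup>2) = (\<Sum>b\<in>I. \<mu> b * (G b)\<^sup>2)"
      using assms(1) by (intro sum.cong refl) (simp add: power_mult_distrib)
    ultimately show ?thesis by simp
  qed
  also have "\<dots> \<le> r\<^sup>2" by fact
  finally show ?thesis using assms(4) by (rule power2_le_imp_le)
qed

text \<open>As \<open>l\<close> is bounded by 1, the left side is at most the mean absolute
  difference of the likelihood ratio. Passing to the root mean square brings in orthogonality; the 2
  is the square root of the 4 in the hypothesis on \<open>N\<close>.\<close>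

lemma fdiff_expectation_le:
  fixes p :: "'a \<Rightarrow> 'b \<Rightarrow> real"
  assumes A: "A \<ge> 0" and J: "finite J" "\<And>j. j \<in> J \<Longrightarrow> finite (B j)"
    and p: "\<And>j c. j \<in> J \<Longrightarrow> c \<in> B j \<Longrightarrow> p j c \<ge> 0" "\<And>j. j \<in> J \<Longrightarrow> sum (p j) (B j) = 1"
    and f0: "\<And>j s. j \<in> J \<Longrightarrow> (\<Sum>c\<in>B j. p j c * f j c s) = 0"
    and f: "\<And>j c. j \<in> J \<Longrightarrow> c \<in> B j \<Longrightarrow> smooth A t h N (f j c)"
    and N: "(1 + (8 * N)\<^sup>2) ^ card J \<le> 4"
    and l: "\<And>b. b \<in> PiE J B \<Longrightarrow> \<bar>l b\<bar> \<le> 1"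
  shows "\<bar>fdiff h (\<lambda>s. \<Sum>b\<in>PiE J B. l b * (\<Prod>j\<in>J. p j (b j) * (1 + f j (b j) s))) t\<bar> \<le> 2 * weight A h"
proof -
  define \<mu> where "\<mu> b = (\<Prod>j\<in>J. p j (b j))" for b
  define G where "G b = fdiff h (\<lambda>s. \<Prod>j\<in>J. 1 + f j (b j) s) t" for b
  have \<mu>0: "\<mu> b \<ge> 0" if "b \<in> PiE J B" for b
    unfolding \<mu>_def using that p by (intro prod_nonneg) auto
  have \<mu>1: "sum \<mu> (PiE J B) = 1"
    unfolding \<mu>_def using sum_PiE_prod[OF J, where g = p] p by simp
  have "fdiff h (\<lambda>s. \<Sum>b\<in>PiE J B. l b * (\<Prod>j\<in>J. p j (b j) * (1 + f j (b j) s))) t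
      = (\<Sum>b\<in>PiE J B. (l b * \<mu> b) * G b)"
    unfolding fdiff_sum prod.distrib mult.assoc[symmetric] \<mu>_def G_def fdiff_cmult ..
  also have "\<bar>\<dots>\<bar> \<le> (\<Sum>b\<in>PiE J B. \<mu> b * \<bar>G b\<bar>)"
  proof (rule order_trans[OF sum_abs sum_mono])
    fix b assume b: "b \<in> PiE J B"
    have "\<bar>l b\<bar> * (\<mu> b * \<bar>G b\<bar>) \<le> 1 * (\<mu> b * \<bar>G b\<bar>)"
      using l[OF b] \<mu>0[OF b] by (intro mult_right_mono) auto
    then show "\<bar>l b * \<mu> b * G b\<bar> \<le> \<mu> b * \<bar>G b\<bar>"
      using \<mu>0[OF b] by (simp add: abs_mult)
  qed
  also have "\<dots> \<le> 2 * weight A h"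
  proof (rule weighted_abs_sum_le[OF \<mu>0 \<mu>1])
    have "(\<Sum>b\<in>PiE J B. \<mu> b * (G b)\<^sup>2) \<le> (weight A h)\<^sup>2 * (1 + (8 * N)\<^sup>2) ^ card J"
      unfolding \<mu>_def G_def by (rule fdiff_product_second_moment[OF A J p f0 f])
    also have "\<dots> \<le> (weight A h)\<^sup>2 * 4" using N by (intro mult_left_mono) auto
    finally show "(\<Sum>b\<in>PiE J B. \<mu> b * (G b)\<^sup>2) \<le> (2 * weight A h)\<^sup>2"
      by (simp add: power_mult_distrib)
  qed (use weight_nonneg[OF A] in auto)
  finally show ?thesis .
qed

section \<open>Smoothness of the losses in self-play\<close>

lemma finite_actions [simp]: "finite (actions d i)"
  by (simp add: actions_def)

locale oh_play =
  fixes n :: nat and d :: "nat \<Rightarrow> nat" and l :: "nat \<Rightarrow> (nat \<Rightarrow> nat) \<Rightarrow> real" and \<eta> :: real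
  assumes game: "game n d l" and eta_pos: "\<eta> > 0"
begin

abbreviation X :: "nat \<Rightarrow> nat \<Rightarrow> nat \<Rightarrow> real" where "X \<equiv> oh_strategy n d l \<eta>"
abbreviation Lo :: "nat \<Rightarrow> nat \<Rightarrow> nat \<Rightarrow> real" where "Lo \<equiv> oh_loss n d l \<eta>"

lemma actions_nonempty: "i \<in> {1..n} \<Longrightarrow> actions d i \<noteq> {}"
  using game by (auto simp: game_def actions_def)

lemma X_step:
  assumes "t \<ge> 1"
  shows "X (Suc t) i a = X t i a * exp (- \<eta> * (2 * Lo t i a - Lo (t - 1) i a)) /
     (\<Sum>b\<in>actions d i. X t i b * exp (- \<eta> * (2 * Lo t i b - Lo (t - 1) i b)))"
  using assms by (cases t) auto

lemma X_distribution:
  assumes "i \<in> {1..n}" "t \<ge> 1"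
  shows "(\<forall>a\<in>actions d i. X t i a > 0) \<and> (\<Sum>a\<in>actions d i. X t i a) = 1"
  using assms(2)
proof (induction t rule: dec_induct)
  case base
  have "d i \<ge> 1" using game assms(1) by (auto simp: game_def)
  then show ?case by (simp add: actions_def)
next
  case (step t)
  have "(\<Sum>b\<in>actions d i. X t i b * exp (- \<eta> * (2 * Lo t i b - Lo (t - 1) i b))) > 0"
    using step.IH actions_nonempty[OF assms(1)] by (intro sum_pos) auto
  then show ?case
    unfolding X_step[OF step.hyps(1)] sum_divide_distrib[symmetric]
    using step.IH by simp
qed

lemma X_pos: "i \<in> {1..n} \<Longrightarrow> t \<ge> 1 \<Longrightarrow> a \<in> actions d i \<Longrightarrow> X t i a > 0"
  using X_distribution by blast

lemma X_sum: "i \<in> {1..n} \<Longrightarrow> t \<ge> 1 \<Longrightarrow> (\<Sum>a\<in>actions d i. X t i a) = 1"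
  using X_distribution by blast

lemma profile_update:
  assumes "i \<in> {1..n}" "a \<in> actions d i" "b \<in> profiles d ({1..n} - {i})"
  shows "l i (b(i := a)) \<in> {0..1}"
proof -
  have "b(i := a) \<in> profiles d {1..n}"
    using assms unfolding profiles_def by (auto simp: PiE_iff extensional_def)
  then show ?thesis using game assms(1) unfolding game_def by blast
qed

lemma Lo_expected: "t \<ge> 1 \<Longrightarrow> Lo t = expected_loss n d l (X t)"
  by (cases t) auto

lemma Lo_bounds:
  assumes i: "i \<in> {1..n}" and a: "a \<in> actions d i"
  shows "0 \<le> Lo t i a \<and> Lo t i a \<le> 1"
proof (cases "t = 0")
  case False
  then have t: "t \<ge> 1" by simp
  let ?J = "{1..n} - {i}"
  define w where "w b = (\<Prod>j\<in>?J. X t j (b j))" for b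
  have w0: "w b \<ge> 0" if b: "b \<in> profiles d ?J" for b
    unfolding w_def
  proof (rule prod_nonneg)
    fix j assume j: "j \<in> ?J"
    then have "b j \<in> actions d j" using b unfolding profiles_def by (rule PiE_mem[rotated])
    with j show "X t j (b j) \<ge> 0" using X_pos[OF _ t, of j "b j"] by (simp add: less_imp_le)
  qed
  have "sum w (profiles d ?J) = (\<Prod>j\<in>?J. \<Sum>c\<in>actions d j. X t j c)"
    unfolding profiles_def w_def by (rule sum_PiE_prod) auto
  also have "\<dots> = 1" using X_sum[OF _ t] by (intro prod.neutral) auto
  finally have w1: "sum w (profiles d ?J) = 1" .
  have "Lo t i a = (\<Sum>b\<in>profiles d ?J. l i (b(i := a)) * w b)"
    using t by (simp add: Lo_expected expected_loss_def w_def)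
  moreover have "0 \<le> l i (b(i := a)) * w b \<and> l i (b(i := a)) * w b \<le> w b"
    if b: "b \<in> profiles d ?J" for b
    using w0[OF b] profile_update[OF i a b] by (simp add: mult_left_le_one_le)
  then have "0 \<le> (\<Sum>b\<in>profiles d ?J. l i (b(i := a)) * w b)"
    "(\<Sum>b\<in>profiles d ?J. l i (b(i := a)) * w b) \<le> sum w (profiles d ?J)"
    by (meson sum_nonneg, meson sum_mono)
  ultimately show ?thesis unfolding w1 by simp
qed simp

text \<open>Change of the log-weight since the base round \<open>t\<close>, up to a constant common
  to all actions that the normalisation removes.\<close>

definition logit_change :: "nat \<Rightarrow> nat \<Rightarrow> nat \<Rightarrow> nat \<Rightarrow> real" where
  "logit_change t j b s = - \<eta> * (\<Sum>r\<in>{t..<s}. 2 * Lo r j b - Lo (r - 1) j b)"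

lemma logit_change_Suc:
  "t \<le> s \<Longrightarrow> logit_change t j b (Suc s) = logit_change t j b s + - \<eta> * (2 * Lo s j b - Lo (s - 1) j b)"
  by (simp add: logit_change_def algebra_simps)

lemma X_closed_form:
  assumes "j \<in> {1..n}" "t \<ge> 1" "t \<le> s"
  shows "X s j b = X t j b * exp (logit_change t j b s) /
    (\<Sum>c\<in>actions d j. X t j c * exp (logit_change t j c s))"
  using assms(3)
proof (induction s arbitrary: b rule: dec_induct)
  case base
  then show ?case using X_sum[OF assms(1,2)] by (simp add: logit_change_def)
next
  case (step s)
  let ?e = "\<lambda>c. exp (- \<eta> * (2 * Lo s j c - Lo (s - 1) j c))"
  let ?Z = "\<Sum>c\<in>actions d j. X t j c * exp (logit_change t j c s)"
  have Z: "?Z > 0"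
    using X_pos[OF assms(1,2)] actions_nonempty[OF assms(1)] by (intro sum_pos) auto
  have e: "X s j c * ?e c = X t j c * exp (logit_change t j c (Suc s)) / ?Z" for c
    unfolding step.IH[of c] logit_change_Suc[OF step.hyps(1)] exp_add by simp
  have "X (Suc s) j b = X s j b * ?e b / (\<Sum>c\<in>actions d j. X s j c * ?e c)"
    using step.hyps assms(2) by (intro X_step) simp
  also have "\<dots> = X t j b * exp (logit_change t j b (Suc s)) / ?Z /
     (\<Sum>c\<in>actions d j. X t j c * exp (logit_change t j c (Suc s)) / ?Z)"
    unfolding e ..
  also have "\<dots> = X t j b * exp (logit_change t j b (Suc s)) / (\<Sum>c\<in>actions d j. X t j c * exp (logit_change t j c (Suc s)))"
    unfolding sum_divide_distrib[symmetric] using Z by simp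
  finally show ?case .
qed

lemma logit_change_fdiff:
  assumes "t \<ge> 1" "t \<le> s"
  shows "fdiff (Suc k) (logit_change t j b) s =
    - \<eta> * (2 * fdiff k (\<lambda>r. Lo r j b) s - fdiff k (\<lambda>r. Lo r j b) (s - 1))"
proof -
  have sh: "fdiff k (\<lambda>r. f (r - 1)) s = fdiff k f (s - 1)" if "s \<ge> 1" for f :: "nat \<Rightarrow> real" and k s
    using that by (induction k arbitrary: s) (auto simp: Suc_diff_le)
  have "fdiff (Suc k) (logit_change t j b) s =
     fdiff k (\<lambda>r. - \<eta> * (2 * Lo r j b + (-1) * Lo (r - 1) j b)) s"
    unfolding fdiff_Suc' using assms by (intro fdiff_cong) (simp add: logit_change_Suc)
  also have "\<dots> = - \<eta> * (2 * fdiff k (\<lambda>r. Lo r j b) s - fdiff k (\<lambda>r. Lo r j b) (s - 1))"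
    unfolding fdiff_cmult fdiff_add using sh[of s k "\<lambda>r. Lo r j b"] assms by simp
  finally show ?thesis .
qed

text \<open>The ratio of consecutive weights is \<open>A * (k + 1) ^ 3 / (k + 2)\<^sup>2\<close>,
  smallest at \<open>k = 0\<close> with value \<open>A / 4\<close>. This pays for the order lost
  when differences of the logits are expressed by those of the losses.\<close>

lemma weight_le_Suc:
  assumes "A > 0"
  shows "weight A k \<le> 4 / A * weight A (Suc k)"
proof -
  have cubic: "(real k + 2)\<^sup>2 \<le> 4 * (real k + 1) ^ 3"
  proof -
    have "4 * (real k + 1) ^ 3 - (real k + 2)\<^sup>2 = real k * (4 * (real k)\<^sup>2 + 11 * real k + 8)"
      by (simp add: power2_eq_square power3_eq_cube algebra_simps)
    moreover have "\<dots> \<ge> 0" by simp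
    ultimately show ?thesis by linarith
  qed
  have recip: "1 / x\<^sup>2 \<le> 4 * x / y\<^sup>2" if "y\<^sup>2 \<le> 4 * x ^ 3" "x > 0" "y > 0" for x y :: real
    using that by (simp add: field_simps power2_eq_square power3_eq_cube)
  have "1 / (real k + 1)\<^sup>2 \<le> 4 * (real k + 1) / (real k + 2)\<^sup>2"
    by (rule recip[OF cubic]) auto
  then have "fact k * A ^ k * (1 / (real k + 1)\<^sup>2) \<le> fact k * A ^ k * (4 * (real k + 1) / (real k + 2)\<^sup>2)"
    using assms by (intro mult_left_mono) auto
  also have "\<dots> = 4 / A * weight A (Suc k)"
    using assms by (simp add: weight_def algebra_simps)
  finally show ?thesis by (simp add: weight_def)
qed

text \<open>
  The hypothesis \<open>h < t\<close> keeps the convention that the loss in round \<open>0\<close> vanishes out of the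
  differences: each order of the induction looks one round further back.
\<close>

lemma fdiff_loss_le:
  assumes A: "A > 0" and M: "32 * M \<le> 1" "24 * \<eta> \<le> M * A" "3 * \<eta> * real H \<le> M"
    and Mn: "(1 + (80 * M)\<^sup>2) ^ n \<le> 4"
  shows "h \<le> H \<Longrightarrow> h < t \<Longrightarrow> i \<in> {1..n} \<Longrightarrow> a \<in> actions d i \<Longrightarrow>
    \<bar>fdiff h (\<lambda>s. Lo s i a) t\<bar> \<le> 2 * weight A h"
proof (induction h arbitrary: t i a rule: less_induct)
  case (less h)
  have t: "t \<ge> 1" using less.prems by simp
  let ?J = "{1..n} - {i}"
  define f where "f j c s = exp (logit_change t j c s) /
      (\<Sum>b\<in>actions d j. X t j b * exp (logit_change t j b s)) - 1" for j c s
  \<comment> \<open>Order 0 relies on the losses being in [0, 1] over at most \<open>H\<close>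
    rounds, the source of the hypothesis on \<open>3 * \<eta> * real H\<close>. Positive orders use
    the induction hypothesis one order lower, where \<open>6 = 2 * (2 + 1)\<close> and the 4 of
    \<open>weight_le_Suc\<close> make up the 24.\<close>
  have u: "smooth A t h M (logit_change t j c)" if j: "j \<in> {1..n}" and c: "c \<in> actions d j" for j c
    unfolding smooth_def
  proof (intro allI impI)
    fix k s assume s: "t \<le> s" "s + k \<le> t + h"
    show "\<bar>fdiff k (logit_change t j c) s\<bar> \<le> M * weight A k"
    proof (cases k)
      case 0
      have "\<bar>\<Sum>r\<in>{t..<s}. 2 * Lo r j c - Lo (r - 1) j c\<bar> \<le> (\<Sum>r\<in>{t..<s}. 3)"
      proof (rule order_trans[OF sum_abs sum_mono])
        fix r
        show "\<bar>2 * Lo r j c - Lo (r - 1) j c\<bar> \<le> 3"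
          using Lo_bounds[OF j c, of r] Lo_bounds[OF j c, of "r - 1"] by linarith
      qed
      also have "\<dots> \<le> 3 * real H" using s less.prems(1) 0 by simp
      finally have "\<eta> * \<bar>\<Sum>r\<in>{t..<s}. 2 * Lo r j c - Lo (r - 1) j c\<bar> \<le> \<eta> * (3 * real H)"
        using eta_pos by (intro mult_left_mono) auto
      also have "\<dots> \<le> M" using M(3) by simp
      finally show ?thesis using 0 eta_pos by (simp add: logit_change_def abs_mult)
    next
      case (Suc k')
      have "\<bar>fdiff k' (\<lambda>r. Lo r j c) s\<bar> \<le> 2 * weight A k'"
           "\<bar>fdiff k' (\<lambda>r. Lo r j c) (s - 1)\<bar> \<le> 2 * weight A k'"
        using Suc s less.prems(1,2) j c by (auto intro!: less.IH)
      then have "\<bar>2 * fdiff k' (\<lambda>r. Lo r j c) s - fdiff k' (\<lambda>r. Lo r j c) (s - 1)\<bar> \<le> 6 * weight A k'"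
        by linarith
      also have "\<dots> \<le> 6 * (4 / A * weight A k)"
        unfolding Suc by (intro mult_left_mono weight_le_Suc A) auto
      finally have "\<eta> * \<bar>2 * fdiff k' (\<lambda>r. Lo r j c) s - fdiff k' (\<lambda>r. Lo r j c) (s - 1)\<bar>
          \<le> \<eta> * (6 * (4 / A * weight A k))"
        using eta_pos by (intro mult_left_mono) auto
      also have "\<dots> = 24 * \<eta> / A * weight A k" by simp
      also have "\<dots> \<le> M * weight A k"
        using M(2) A by (intro mult_right_mono weight_nonneg) (auto simp: field_simps)
      finally show ?thesis
        unfolding Suc logit_change_fdiff[OF t s(1)] using eta_pos by (simp add: abs_mult)
    qed
  qed
  have f: "smooth A t h (10 * M) (f j c)" if j: "j \<in> ?J" and c: "c \<in> actions d j" for j c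
    unfolding f_def
  proof (rule smooth_softmax_ratio[where p = "X t j" and B = "actions d j" and u = "logit_change t j"])
    show "0 \<le> X t j b" if "b \<in> actions d j" for b
      using X_pos[OF _ t that] j by (simp add: less_imp_le)
    show "sum (X t j) (actions d j) = 1" using X_sum j t by simp
    show "smooth A t h M (logit_change t j b)" if "b \<in> actions d j" for b
      using u j that by simp
  qed (use A M(1) c in auto)
  \<comment> \<open>Both \<open>X t j c\<close> and \<open>X t j c * (1 + f j c s)\<close> sum to 1
    over \<open>c\<close>, so the excess \<open>f\<close> is centred under the base
    strategy.\<close>
  have f0: "(\<Sum>c\<in>actions d j. X t j c * f j c s) = 0" if j: "j \<in> ?J" for j s
  proof -
    let ?Z = "\<Sum>b\<in>actions d j. X t j b * exp (logit_change t j b s)"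
    have Z: "?Z > 0"
      using X_pos[of j t] actions_nonempty[of j] j t by (intro sum_pos) auto
    have "(\<Sum>c\<in>actions d j. X t j c * f j c s)
       = (\<Sum>c\<in>actions d j. X t j c * exp (logit_change t j c s) / ?Z) - (\<Sum>c\<in>actions d j. X t j c)"
      unfolding f_def by (simp add: sum_subtractf algebra_simps)
    also have "\<dots> = 0"
      unfolding sum_divide_distrib[symmetric] using Z j t by (simp add: X_sum)
    finally show ?thesis .
  qed
  have "\<bar>fdiff h (\<lambda>s. \<Sum>b\<in>PiE ?J (actions d). l i (b(i := a)) *
      (\<Prod>j\<in>?J. X t j (b j) * (1 + f j (b j) s))) t\<bar> \<le> 2 * weight A h"
  proof (rule fdiff_expectation_le[where N = "10 * M"])
    have "(1 + (8 * (10 * M))\<^sup>2) ^ card ?J \<le> (1 + (80 * M)\<^sup>2) ^ n"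
      using less.prems(3) by (simp add: power_increasing)
    then show "(1 + (8 * (10 * M))\<^sup>2) ^ card ?J \<le> 4" using Mn by linarith
    show "\<bar>l i (b(i := a))\<bar> \<le> 1" if "b \<in> PiE ?J (actions d)" for b
      using profile_update[OF less.prems(3,4), of b] that by (simp add: profiles_def)
    show "0 \<le> X t j c" if "j \<in> ?J" "c \<in> actions d j" for j c
      using X_pos[OF _ t that(2)] that(1) by (simp add: less_imp_le)
    show "sum (X t j) (actions d j) = 1" if "j \<in> ?J" for j
      using X_sum that t by simp
  qed (use A f f0 in auto)
  also have "fdiff h (\<lambda>s. \<Sum>b\<in>PiE ?J (actions d). l i (b(i := a)) *
      (\<Prod>j\<in>?J. X t j (b j) * (1 + f j (b j) s))) t = fdiff h (\<lambda>s. Lo s i a) t"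
  proof (rule fdiff_cong)
    fix s assume s: "t \<le> s"
    have eq: "X t j c * (1 + f j c s) = X s j c" if "j \<in> ?J" for j c
      unfolding f_def by (subst X_closed_form[of j t s c]) (use that s t in auto)
    have "Lo s i a = (\<Sum>b\<in>PiE ?J (actions d). l i (b(i := a)) * (\<Prod>j\<in>?J. X s j (b j)))"
      using s t by (simp add: Lo_expected expected_loss_def profiles_def)
    also have "\<dots> = (\<Sum>b\<in>PiE ?J (actions d). l i (b(i := a)) * (\<Prod>j\<in>?J. X t j (b j) * (1 + f j (b j) s)))"
      by (intro sum.cong refl arg_cong2[where f = "(*)"] prod.cong) (simp only: eq)
    finally show "(\<Sum>b\<in>PiE ?J (actions d). l i (b(i := a)) * (\<Prod>j\<in>?J. X t j (b j) * (1 + f j (b j) s)))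
       = Lo s i a" ..
  qed
  finally show ?case .
qed

end

section \<open>Contraction of variances\<close>

text \<open>For a probability vector \<open>p\<close> this is the covariance. The pairwise form
  contains no mean depending on \<open>p\<close>, so replacing \<open>p\<close> by a close
  distribution only changes the factor \<open>p a * p b\<close> of each term.\<close>

definition cov :: "'a set \<Rightarrow> ('a \<Rightarrow> real) \<Rightarrow> ('a \<Rightarrow> real) \<Rightarrow> ('a \<Rightarrow> real) \<Rightarrow> real" where
  "cov S p f g = (\<Sum>a\<in>S. \<Sum>b\<in>S. p a * p b * ((f a - f b) * (g a - g b))) / 2"

lemma cov_add_left: "cov S p (\<lambda>a. f a + g a) k = cov S p f k + cov S p g k"
  by (simp add: cov_def algebra_simps sum.distrib sum_subtractf add_divide_distrib diff_divide_distrib)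

lemma cov_add_right: "cov S p k (\<lambda>a. f a + g a) = cov S p k f + cov S p k g"
  by (simp add: cov_def algebra_simps sum.distrib sum_subtractf add_divide_distrib diff_divide_distrib)

lemma cov_self_nonneg: "(\<And>a. a \<in> S \<Longrightarrow> p a \<ge> 0) \<Longrightarrow> cov S p f f \<ge> 0"
  unfolding cov_def by (intro divide_nonneg_pos sum_nonneg) auto

lemma weighted_AM_GM:
  fixes u v \<theta> :: real
  assumes "\<theta> > 0"
  shows "\<bar>u * v\<bar> \<le> \<theta> / 2 * (u * u) + 1 / (2 * \<theta>) * (v * v)"
proof -
  have "0 \<le> (\<theta> * \<bar>u\<bar> - \<bar>v\<bar>)\<^sup>2 / (2 * \<theta>)" using assms by simp
  also have "\<dots> = \<theta> / 2 * (u * u) + 1 / (2 * \<theta>) * (v * v) - \<bar>u * v\<bar>"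
    using assms by (simp add: power2_diff power_mult_distrib abs_mult field_simps power2_eq_square)
  finally show ?thesis by simp
qed

lemma cov_abs_le:
  assumes "\<And>a. a \<in> S \<Longrightarrow> p a \<ge> 0" "\<theta> > 0"
  shows "\<bar>cov S p f g\<bar> \<le> \<theta> / 2 * cov S p f f + 1 / (2 * \<theta>) * cov S p g g"
proof -
  have "\<bar>\<Sum>a\<in>S. \<Sum>b\<in>S. p a * p b * ((f a - f b) * (g a - g b))\<bar>
      \<le> (\<Sum>a\<in>S. \<Sum>b\<in>S. \<bar>p a * p b * ((f a - f b) * (g a - g b))\<bar>)"
    by (rule order_trans[OF sum_abs sum_mono[OF sum_abs]])
  also have "\<dots> \<le> (\<Sum>a\<in>S. \<Sum>b\<in>S. p a * p b * (\<theta> / 2 * ((f a - f b) * (f a - f b))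
       + 1 / (2 * \<theta>) * ((g a - g b) * (g a - g b))))"
  proof (intro sum_mono)
    fix a b assume ab: "a \<in> S" "b \<in> S"
    then have "0 \<le> p a * p b" using assms(1) by simp
    then have "\<bar>p a * p b * ((f a - f b) * (g a - g b))\<bar> = p a * p b * \<bar>(f a - f b) * (g a - g b)\<bar>"
      by (subst abs_mult) (simp only: abs_of_nonneg)
    also have "\<dots> \<le> p a * p b * (\<theta> / 2 * ((f a - f b) * (f a - f b))
       + 1 / (2 * \<theta>) * ((g a - g b) * (g a - g b)))"
      using \<open>0 \<le> p a * p b\<close> by (rule mult_left_mono[OF weighted_AM_GM[OF assms(2)]])
    finally show "\<bar>p a * p b * ((f a - f b) * (g a - g b))\<bar> \<le> \<dots>" .
  qed
  also have "\<dots> = \<theta> / 2 * (\<Sum>a\<in>S. \<Sum>b\<in>S. p a * p b * ((f a - f b) * (f a - f b)))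
      + 1 / (2 * \<theta>) * (\<Sum>a\<in>S. \<Sum>b\<in>S. p a * p b * ((g a - g b) * (g a - g b)))"
    unfolding sum_distrib_left sum.distrib[symmetric]
    by (intro sum.cong refl) (simp only: distrib_left ac_simps)
  finally show ?thesis unfolding cov_def by (simp add: field_simps)
qed

lemma cov_change:
  assumes "\<And>a. a \<in> S \<Longrightarrow> p a \<ge> 0"
    and "\<And>a b. a \<in> S \<Longrightarrow> b \<in> S \<Longrightarrow> \<bar>q a * q b - p a * p b\<bar> \<le> \<epsilon> * (p a * p b)"
  shows "\<bar>cov S q f g - cov S p f g\<bar> \<le> \<epsilon> * (1 / 2 * cov S p f f + 1 / 2 * cov S p g g)"
proof -
  let ?m = "\<lambda>a b. (f a - f b) * (g a - g b)"
  have half: "\<bar>x / 2\<bar> \<le> e * (1 / 2 * (F / 2) + 1 / 2 * (G / 2))"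
    if "\<bar>x\<bar> \<le> e * (1 / 2 * F + 1 / 2 * G)" for x e F G :: real
    using that by (simp add: field_simps)
  have diff: "cov S q f g - cov S p f g = (\<Sum>a\<in>S. \<Sum>b\<in>S. (q a * q b - p a * p b) * ?m a b) / 2"
    unfolding cov_def by (simp only: left_diff_distrib sum_subtractf diff_divide_distrib)
  have "\<bar>\<Sum>a\<in>S. \<Sum>b\<in>S. (q a * q b - p a * p b) * ?m a b\<bar>
      \<le> (\<Sum>a\<in>S. \<Sum>b\<in>S. \<bar>(q a * q b - p a * p b) * ?m a b\<bar>)"
    by (rule order_trans[OF sum_abs sum_mono[OF sum_abs]])
  also have "\<dots> \<le> (\<Sum>a\<in>S. \<Sum>b\<in>S. \<epsilon> * (p a * p b * (1 / 2 * ((f a - f b) * (f a - f b))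
       + 1 / 2 * ((g a - g b) * (g a - g b)))))"
  proof (intro sum_mono)
    fix a b assume ab: "a \<in> S" "b \<in> S"
    have "\<bar>(q a * q b - p a * p b) * ?m a b\<bar> \<le> \<epsilon> * (p a * p b) * \<bar>?m a b\<bar>"
      unfolding abs_mult using assms(2)[OF ab] by (intro mult_right_mono) auto
    also have "\<dots> \<le> \<epsilon> * (p a * p b) * (1 / 2 * ((f a - f b) * (f a - f b))
       + 1 / (2 * 1) * ((g a - g b) * (g a - g b)))"
      using assms(2)[OF ab] weighted_AM_GM[of 1 "f a - f b" "g a - g b"]
      by (intro mult_left_mono) auto
    finally show "\<bar>(q a * q b - p a * p b) * ?m a b\<bar> \<le>
      \<epsilon> * (p a * p b * (1 / 2 * ((f a - f b) * (f a - f b)) + 1 / 2 * ((g a - g b) * (g a - g b))))"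
      by (simp only: mult.assoc mult_1_right)
  qed
  also have "\<dots> = \<epsilon> * (1 / 2 * (\<Sum>a\<in>S. \<Sum>b\<in>S. p a * p b * ((f a - f b) * (f a - f b)))
      + 1 / 2 * (\<Sum>a\<in>S. \<Sum>b\<in>S. p a * p b * ((g a - g b) * (g a - g b))))"
    unfolding sum_distrib_left sum.distrib[symmetric]
    by (intro sum.cong refl) (simp only: distrib_left ac_simps)
  finally show ?thesis unfolding diff unfolding cov_def by (rule half)
qed

lemma cov_self_le:
  assumes "\<And>a. a \<in> S \<Longrightarrow> p a \<ge> 0" "sum p S = 1" "\<And>a. a \<in> S \<Longrightarrow> \<bar>f a\<bar> \<le> B"
  shows "cov S p f f \<le> 2 * B\<^sup>2"
proof -
  have "(\<Sum>a\<in>S. \<Sum>b\<in>S. p a * p b * ((f a - f b) * (f a - f b))) \<le> (\<Sum>a\<in>S. \<Sum>b\<in>S. p a * p b * (2 * B)\<^sup>2)"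
  proof (intro sum_mono mult_left_mono)
    fix a b assume ab: "a \<in> S" "b \<in> S"
    then have "\<bar>f a - f b\<bar> \<le> 2 * B" using assms(3)[of a] assms(3)[of b] by linarith
    from power_mono[OF this, of 2] show "(f a - f b) * (f a - f b) \<le> (2 * B)\<^sup>2"
      by (simp add: power2_eq_square)
  qed (use assms(1) in auto)
  also have "\<dots> = (\<Sum>a\<in>S. p a) * (\<Sum>b\<in>S. p b) * (2 * B)\<^sup>2"
    by (simp only: sum_distrib_left[symmetric] sum_distrib_right[symmetric])
  finally show ?thesis unfolding cov_def by (simp add: assms(2) power2_eq_square)
qed

lemma cov_self_eq:
  assumes "sum p S = 1" "m = (\<Sum>a\<in>S. p a * f a)"
  shows "cov S p f f = (\<Sum>a\<in>S. p a * (f a - m)\<^sup>2)"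
proof -
  have "(\<Sum>a\<in>S. \<Sum>b\<in>S. p a * p b * ((f a - f b) * (f a - f b)))
     = (\<Sum>a\<in>S. \<Sum>b\<in>S. (p a * (f a)\<^sup>2) * p b + p a * (p b * (f b)\<^sup>2) - 2 * ((p a * f a) * (p b * f b)))"
    by (intro sum.cong refl) (simp add: algebra_simps power2_eq_square)
  also have "\<dots> = (\<Sum>a\<in>S. p a * (f a)\<^sup>2) * sum p S + sum p S * (\<Sum>a\<in>S. p a * (f a)\<^sup>2) - 2 * (m * m)"
    unfolding assms(2)
    by (simp only: sum.distrib sum_subtractf sum_distrib_left[symmetric] sum_distrib_right[symmetric])
  also have "\<dots> = 2 * ((\<Sum>a\<in>S. p a * (f a)\<^sup>2) - m\<^sup>2)"
    by (simp add: assms(1) power2_eq_square)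
  also have "(\<Sum>a\<in>S. p a * (f a)\<^sup>2) - m\<^sup>2 = (\<Sum>a\<in>S. p a * (f a - m)\<^sup>2)"
  proof -
    have "(\<Sum>a\<in>S. p a * (f a - m)\<^sup>2) = (\<Sum>a\<in>S. p a * (f a)\<^sup>2 + m\<^sup>2 * p a - 2 * m * (p a * f a))"
      by (intro sum.cong refl) (simp add: algebra_simps power2_eq_square)
    also have "\<dots> = (\<Sum>a\<in>S. p a * (f a)\<^sup>2) + m\<^sup>2 * sum p S - 2 * m * m"
      unfolding assms(2) by (simp only: sum.distrib sum_subtractf sum_distrib_left)
    finally show ?thesis by (simp add: assms(1) power2_eq_square)
  qed
  finally show ?thesis unfolding cov_def by simp
qed

text \<open>
  Summation by parts against the slowly varying distributions \<open>p s\<close>. Up to boundary terms it makes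
  the sums over \<open>s\<close> of \<open>V h s\<close> log-convex in \<open>h\<close>.
\<close>

lemma covariance_increment:
  fixes S :: "'a set" and f :: "nat \<Rightarrow> 'a \<Rightarrow> real" and p :: "nat \<Rightarrow> 'a \<Rightarrow> real"
  defines "D \<equiv> \<lambda>h s a. fdiff h (\<lambda>r. f r a) s"
  defines "V \<equiv> \<lambda>h s. cov S (p s) (D h s) (D h s)"
  defines "Q \<equiv> \<lambda>h s. cov S (p s) (D (Suc h) s) (D h s)"
  assumes p: "\<And>s a. a \<in> S \<Longrightarrow> p s a \<ge> 0"
    and ch: "\<And>a b. a \<in> S \<Longrightarrow> b \<in> S \<Longrightarrow>
       \<bar>p s a * p s b - p (Suc s) a * p (Suc s) b\<bar> \<le> \<epsilon> * (p (Suc s) a * p (Suc s) b)"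
    and \<theta>: "\<theta> > 0"
  shows "V (Suc h) s \<le> Q h (Suc s) - Q h s + \<epsilon> / 2 * (V (Suc h) (Suc s) + V h (Suc s))
     + \<theta> / 2 * V (Suc (Suc h)) s + (1 + \<epsilon>) / (2 * \<theta>) * V h (Suc s)"
proof -
  let ?c = "cov S (p s)"
  have D: "D h (Suc s) = (\<lambda>a. D h s a + D (Suc h) s a)" for h by (simp add: D_def)
  \<comment> \<open>Product rule under the fixed \<open>p s\<close>: advancing both arguments by one
    round adds \<open>V (Suc h) s\<close> and a remainder with a difference of order
    \<open>h + 2\<close>. The following facts move the left side to \<open>p (Suc s)\<close> and
    estimate the remainder.\<close>
  have "?c (D (Suc h) (Suc s)) (D h (Suc s)) = Q h s + V (Suc h) s + ?c (D (Suc (Suc h)) s) (D h (Suc s))"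
    unfolding D[of "Suc h"] cov_add_left unfolding D[of h] cov_add_right Q_def V_def by simp
  moreover have "\<bar>?c (D (Suc h) (Suc s)) (D h (Suc s)) - Q h (Suc s)\<bar> \<le>
      \<epsilon> * (1 / 2 * V (Suc h) (Suc s) + 1 / 2 * V h (Suc s))"
    unfolding Q_def V_def by (rule cov_change[OF p ch])
  moreover have "\<bar>?c (D (Suc (Suc h)) s) (D h (Suc s))\<bar>
      \<le> \<theta> / 2 * V (Suc (Suc h)) s + 1 / (2 * \<theta>) * ?c (D h (Suc s)) (D h (Suc s))"
    unfolding V_def by (rule cov_abs_le[OF p \<theta>])
  moreover have "1 / (2 * \<theta>) * ?c (D h (Suc s)) (D h (Suc s)) \<le> 1 / (2 * \<theta>) * ((1 + \<epsilon>) * V h (Suc s))"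
  proof (rule mult_left_mono)
    have "\<bar>?c (D h (Suc s)) (D h (Suc s)) - V h (Suc s)\<bar> \<le>
      \<epsilon> * (1 / 2 * V h (Suc s) + 1 / 2 * V h (Suc s))"
      unfolding V_def by (rule cov_change[OF p ch])
    then show "?c (D h (Suc s)) (D h (Suc s)) \<le> (1 + \<epsilon>) * V h (Suc s)"
      by (simp add: algebra_simps)
  qed (use \<theta> in simp)
  ultimately show ?thesis by (simp add: algebra_simps add_divide_distrib)
qed

text \<open>Summed over the rounds, the increments of \<open>Q\<close> telescope to two boundary
  terms of size at most \<open>\<beta>\<close>, and shifting a sum by one round costs another
  \<open>\<beta>\<close>. An optimal \<open>\<theta>\<close> would turn the last two terms into
  essentially the geometric mean of the sums of orders \<open>h\<close> and
  \<open>h + 2\<close>.\<close>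

lemma variance_sum_step:
  fixes S :: "'a set" and f :: "nat \<Rightarrow> 'a \<Rightarrow> real" and p :: "nat \<Rightarrow> 'a \<Rightarrow> real"
  defines "V \<equiv> \<lambda>h s. cov S (p s) (\<lambda>a. fdiff h (\<lambda>r. f r a) s) (\<lambda>a. fdiff h (\<lambda>r. f r a) s)"
  assumes p: "\<And>s a. a \<in> S \<Longrightarrow> p s a \<ge> 0"
    and ch: "\<And>s a b. s \<ge> m \<Longrightarrow> a \<in> S \<Longrightarrow> b \<in> S \<Longrightarrow>
       \<bar>p s a * p s b - p (Suc s) a * p (Suc s) b\<bar> \<le> \<epsilon> * (p (Suc s) a * p (Suc s) b)"
    and \<theta>: "\<theta> > 0" and \<epsilon>: "\<epsilon> \<ge> 0" and m: "m \<le> T"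
    and \<beta>: "\<And>s. s \<ge> m \<Longrightarrow> V h s \<le> \<beta>" "\<And>s. s \<ge> m \<Longrightarrow> V (Suc h) s \<le> \<beta>"
  shows "(\<Sum>s=m..<T. V (Suc h) s) \<le> 2 * \<beta>
     + \<epsilon> / 2 * ((\<Sum>s=m..<T. V (Suc h) s) + (\<Sum>s=m..<T. V h s) + 2 * \<beta>)
     + \<theta> / 2 * (\<Sum>s=m..<T. V (Suc (Suc h)) s) + (1 + \<epsilon>) / (2 * \<theta>) * ((\<Sum>s=m..<T. V h s) + \<beta>)"
proof -
  define Q where "Q s = cov S (p s) (\<lambda>a. fdiff (Suc h) (\<lambda>r. f r a) s) (\<lambda>a. fdiff h (\<lambda>r. f r a) s)" for s
  have Q: "\<bar>Q s\<bar> \<le> \<beta>" if "s \<ge> m" for s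
    using cov_abs_le[where S = S and p = "p s" and \<theta> = 1 and f = "\<lambda>a. fdiff (Suc h) (\<lambda>r. f r a) s"
        and g = "\<lambda>a. fdiff h (\<lambda>r. f r a) s", OF p]
      \<beta>[OF that] unfolding Q_def V_def by linarith
  have V0: "V k s \<ge> 0" for k s unfolding V_def by (rule cov_self_nonneg[OF p])
  have shift: "(\<Sum>s=m..<T. V k (Suc s)) \<le> (\<Sum>s=m..<T. V k s) + \<beta>" if "V k T \<le> \<beta>" for k
  proof -
    have "(\<Sum>s=m..<T. V k (Suc s)) = (\<Sum>s=Suc m..<Suc T. V k s)"
      by (rule sum.shift_bounds_Suc_ivl[symmetric])
    also have "\<dots> \<le> (\<Sum>s=m..<Suc T. V k s)"
      using V0 by (intro sum_mono2) auto
    finally show ?thesis using m that by simp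
  qed
  have "(\<Sum>s=m..<T. V (Suc h) s) \<le> (\<Sum>s=m..<T. Q (Suc s) - Q s
     + \<epsilon> / 2 * (V (Suc h) (Suc s) + V h (Suc s))
     + \<theta> / 2 * V (Suc (Suc h)) s + (1 + \<epsilon>) / (2 * \<theta>) * V h (Suc s))"
    unfolding Q_def V_def by (intro sum_mono covariance_increment p ch \<theta>) auto
  also have "\<dots> = Q T - Q m
     + \<epsilon> / 2 * ((\<Sum>s=m..<T. V (Suc h) (Suc s)) + (\<Sum>s=m..<T. V h (Suc s)))
     + \<theta> / 2 * (\<Sum>s=m..<T. V (Suc (Suc h)) s) + (1 + \<epsilon>) / (2 * \<theta>) * (\<Sum>s=m..<T. V h (Suc s))"
    using sum_Suc_diff'[OF m, of Q] by (simp only: sum.distrib sum_distrib_left[symmetric])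
  also have "\<dots> \<le> 2 * \<beta>
     + \<epsilon> / 2 * (((\<Sum>s=m..<T. V (Suc h) s) + \<beta>) + ((\<Sum>s=m..<T. V h s) + \<beta>))
     + \<theta> / 2 * (\<Sum>s=m..<T. V (Suc (Suc h)) s) + (1 + \<epsilon>) / (2 * \<theta>) * ((\<Sum>s=m..<T. V h s) + \<beta>)"
    using Q[of T] Q[of m] m \<theta> \<epsilon>
    by (intro add_mono mult_left_mono shift \<beta>) auto
  finally show ?thesis by (simp add: algebra_simps)
qed

text \<open>
  By downward induction, \<open>a (h + 1) \<le> \<delta> * a h + 80 / 64 ^ h\<close> with a factor \<open>\<delta>\<close> that starts at \<open>1 / 16\<close> and
  grows by \<open>1 + 20 * \<epsilon>\<close> in each of the \<open>H\<close> steps, hence stays below \<open>1 / 8\<close>; the optimal weight in the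
  step inequality is \<open>\<theta> = 1 / \<delta>\<close>.
\<close>

lemma contraction_recursion:
  fixes a \<beta> :: "nat \<Rightarrow> real"
  assumes a0: "\<And>h. a h \<ge> 0" and \<epsilon>: "\<epsilon> \<ge> 0" "40 * \<epsilon> * real H \<le> 1" and H: "H \<ge> 1"
    and \<beta>: "\<And>h. h \<le> H \<Longrightarrow> \<beta> h \<le> 8 / 64 ^ h"
    and step: "\<And>h \<theta>. Suc (Suc h) \<le> H \<Longrightarrow> \<theta> > 0 \<Longrightarrow> a (Suc h) \<le> 2 * \<beta> h
     + \<epsilon> / 2 * (a (Suc h) + a h + 2 * \<beta> h) + \<theta> / 2 * a (Suc (Suc h)) + (1 + \<epsilon>) / (2 * \<theta>) * (a h + \<beta> h)"
    and top: "a H \<le> 80 / 64 ^ (H - 1)"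
  shows "a 1 \<le> 1 / 8 * a 0 + 80"
proof -
  define g where "g = 1 + 20 * \<epsilon>"
  have g1: "g \<ge> 1" using \<epsilon> by (simp add: g_def)
  have \<epsilon>1: "\<epsilon> \<le> 1 / 40"
  proof -
    have "40 * \<epsilon> * 1 \<le> 40 * \<epsilon> * real H" using \<epsilon> H by (intro mult_left_mono) auto
    then show ?thesis using \<epsilon>(2) by simp
  qed
  have gH: "g ^ k \<le> 2" if "k \<le> H" for k
  proof -
    have "g ^ k \<le> exp (20 * \<epsilon>) ^ k"
      unfolding g_def using \<epsilon> exp_ge_add_one_self[of "20 * \<epsilon>"] by (intro power_mono) auto
    also have "\<dots> = exp (real k * (20 * \<epsilon>))" by (simp add: exp_of_nat_mult)
    also have "\<dots> \<le> exp (1 / 2)"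
    proof -
      have "real k * (20 * \<epsilon>) \<le> real H * (20 * \<epsilon>)" using \<epsilon> that by (intro mult_right_mono) auto
      then show ?thesis using \<epsilon>(2) by (simp add: algebra_simps)
    qed
    also have "\<dots> \<le> 2" using exp_bound_half[of "1/2::real"] by simp
    finally show ?thesis .
  qed
  have main: "a (Suc (H - 1 - k)) \<le> 1 / 16 * g ^ k * a (H - 1 - k) + 80 / 64 ^ (H - 1 - k)" if "k < H" for k
    using that
  proof (induction k)
    case 0
    have "Suc (H - 1) = H" using H by simp
    then show ?case using top a0[of "H - 1"] by simp
  next
    case (Suc k)
    define h where "h = H - 1 - Suc k"
    have h: "H - 1 - k = Suc h" "Suc (Suc h) \<le> H" using Suc.prems by (auto simp: h_def)
    define \<delta> where "\<delta> = 1 / 16 * g ^ k"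
    have \<delta>: "\<delta> \<ge> 1 / 16" "\<delta> \<le> 1 / 8"
      using g1 gH[of k] Suc.prems by (auto simp: \<delta>_def one_le_power)
    have IH: "a (Suc (Suc h)) \<le> \<delta> * a (Suc h) + 80 / 64 ^ Suc h"
      using Suc h by (simp add: \<delta>_def)
    \<comment> \<open>The weight \<open>1 / \<delta>\<close> turns the next term into half of
      \<open>a (Suc h)\<close>, to be absorbed on the left. It inflates the error by a factor of at
      most 16, which the rate 64 outruns.\<close>
    have "1 / \<delta> / 2 * a (Suc (Suc h)) \<le> 1 / \<delta> / 2 * (\<delta> * a (Suc h) + 80 / 64 ^ Suc h)"
      using \<delta> by (intro mult_left_mono IH) auto
    also have "\<dots> = a (Suc h) / 2 + 1 / \<delta> * (40 / 64 ^ Suc h)"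
      using \<delta> by (simp add: field_simps)
    also have "\<dots> \<le> a (Suc h) / 2 + 16 * (40 / 64 ^ Suc h)"
      using \<delta> by (intro add_left_mono mult_right_mono) (auto simp: field_simps)
    also have "\<dots> = a (Suc h) / 2 + 10 / 64 ^ h" by simp
    finally have top': "1 / \<delta> / 2 * a (Suc (Suc h)) \<le> a (Suc h) / 2 + 10 / 64 ^ h" .
    have st: "a (Suc h) \<le> 2 * \<beta> h + \<epsilon> / 2 * (a (Suc h) + a h + 2 * \<beta> h)
        + 1 / \<delta> / 2 * a (Suc (Suc h)) + (1 + \<epsilon>) * \<delta> / 2 * (a h + \<beta> h)"
      using step[OF h(2), of "1 / \<delta>"] \<delta> by simp
    have \<beta>h: "(4 + 2 * \<epsilon> + (1 + \<epsilon>) * \<delta>) * \<beta> h \<le> 5 * (8 / 64 ^ h)"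
    proof -
      have "(1 + \<epsilon>) * \<delta> \<le> 2 * (1 / 8)" using \<epsilon> \<epsilon>1 \<delta> by (intro mult_mono) auto
      moreover have "(1 + \<epsilon>) * \<delta> \<ge> 0" using \<epsilon> \<delta> by simp
      ultimately have c: "0 \<le> 4 + 2 * \<epsilon> + (1 + \<epsilon>) * \<delta>" "4 + 2 * \<epsilon> + (1 + \<epsilon>) * \<delta> \<le> 5"
        using \<epsilon> \<epsilon>1 by linarith+
      have "(4 + 2 * \<epsilon> + (1 + \<epsilon>) * \<delta>) * \<beta> h \<le> (4 + 2 * \<epsilon> + (1 + \<epsilon>) * \<delta>) * (8 / 64 ^ h)"
        using c h by (intro mult_left_mono \<beta>) auto
      also have "\<dots> \<le> 5 * (8 / 64 ^ h)" using c by (intro mult_right_mono) auto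
      finally show ?thesis .
    qed
    have "(1 - \<epsilon>) * a (Suc h) \<le> (\<epsilon> + (1 + \<epsilon>) * \<delta>) * a h + 20 / 64 ^ h
        + (4 + 2 * \<epsilon> + (1 + \<epsilon>) * \<delta>) * \<beta> h"
      using st top' by (simp add: algebra_simps add_divide_distrib)
    also have "\<dots> \<le> (\<epsilon> + (1 + \<epsilon>) * \<delta>) * a h + 60 / 64 ^ h"
      using \<beta>h by simp
    also have "\<dots> \<le> ((1 - \<epsilon>) * (g * \<delta>)) * a h + (1 - \<epsilon>) * (80 / 64 ^ h)"
    proof (intro add_mono mult_right_mono a0)
      \<comment> \<open>As \<open>16 * \<delta> \<ge> 1\<close>, the additive
        \<open>\<epsilon>\<close> is at most \<open>16 * \<epsilon> * \<delta>\<close>. So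
        \<open>1 + 17 * \<epsilon>\<close> must stay below
        \<open>(1 - \<epsilon>) * (1 + 20 * \<epsilon>)\<close>; the 20 in \<open>g\<close> leaves
        room for this.\<close>
      have "\<epsilon> * \<epsilon> \<le> \<epsilon> * (1 / 40)" using \<epsilon> \<epsilon>1 by (intro mult_left_mono) auto
      then have "17 * \<epsilon> \<le> 19 * \<epsilon> - 20 * (\<epsilon> * \<epsilon>)" using \<epsilon>(1) by simp
      then have "(1 + 17 * \<epsilon>) * \<delta> \<le> (1 + 19 * \<epsilon> - 20 * (\<epsilon> * \<epsilon>)) * \<delta>"
        using \<delta> by (intro mult_right_mono) auto
      moreover have "\<epsilon> * 1 \<le> \<epsilon> * (16 * \<delta>)" using \<epsilon> \<delta> by (intro mult_left_mono) auto
      ultimately show "\<epsilon> + (1 + \<epsilon>) * \<delta> \<le> (1 - \<epsilon>) * (g * \<delta>)"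
        by (simp add: g_def algebra_simps)
      have "60 \<le> (1 - \<epsilon>) * 80" using \<epsilon>1 by simp
      then show "60 / 64 ^ h \<le> (1 - \<epsilon>) * (80 / 64 ^ h)"
        using divide_right_mono[of 60 "(1 - \<epsilon>) * 80" "64 ^ h"] by simp
    qed
    also have "\<dots> = (1 - \<epsilon>) * (g * \<delta> * a h + 80 / 64 ^ h)" by (simp add: algebra_simps)
    finally have "a (Suc h) \<le> g * \<delta> * a h + 80 / 64 ^ h" using \<epsilon>1 by simp
    then show ?case unfolding h_def[symmetric] by (simp add: \<delta>_def algebra_simps)
  qed
  have "a 1 \<le> 1 / 16 * g ^ (H - 1) * a 0 + 80"
    using main[of "H - 1"] H by simp
  also have "1 / 16 * g ^ (H - 1) * a 0 \<le> 1 / 16 * 2 * a 0"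
    using gH[of "H - 1"] g1 a0[of 0] by (intro mult_right_mono) auto
  finally show ?thesis by simp
qed

section \<open>Regret\<close>

lemma exp_quadratic_bounds:
  fixes z :: real
  assumes "\<bar>z\<bar> \<le> 1 / 2"
  shows "1 + z + z\<^sup>2 / 4 \<le> exp z" "exp z \<le> 1 + z + z\<^sup>2"
proof -
  obtain t where t: "\<bar>t\<bar> \<le> \<bar>z\<bar>" "exp z = (\<Sum>m<2. z ^ m / fact m) + exp t / fact 2 * z ^ 2"
    using Maclaurin_exp_le[of z 2] by blast
  have ez: "exp z = 1 + z + exp t / 2 * z\<^sup>2"
    using t(2) by (simp add: numeral_2_eq_2)
  have "1 / 2 \<le> exp t" using exp_ge_add_one_self[of t] t(1) assms by linarith
  then have "1 / 4 * z\<^sup>2 \<le> exp t / 2 * z\<^sup>2" by (intro mult_right_mono) auto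
  then show "1 + z + z\<^sup>2 / 4 \<le> exp z" unfolding ez by simp
  have "exp t \<le> exp (1 / 2)" using t(1) assms by simp
  also have "\<dots> \<le> 2" using exp_bound_half[of "1/2::real"] by simp
  finally have "exp t / 2 * z\<^sup>2 \<le> 1 * z\<^sup>2" by (intro mult_right_mono) auto
  then show "exp z \<le> 1 + z + z\<^sup>2" unfolding ez by simp
qed

text \<open>Centring at the mean removes the linear term, and \<open>exp_quadratic_bounds\<close>
  leaves the variance with the factors 1 and 1 / 4. On the lower side the logarithm costs another
  factor 2, hence 1 / 8.\<close>

lemma ln_mgf_bounds:
  assumes S: "finite S" "\<And>a. a \<in> S \<Longrightarrow> p a \<ge> 0" "sum p S = 1"
    and g: "\<And>a. a \<in> S \<Longrightarrow> \<bar>g a\<bar> \<le> 1" and \<eta>: "0 \<le> \<eta>" "\<eta> \<le> 1 / 4"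
  shows "ln (\<Sum>a\<in>S. p a * exp (\<eta> * g a)) \<le> \<eta> * (\<Sum>a\<in>S. p a * g a) + \<eta>\<^sup>2 * cov S p g g"
    and "\<eta> * (\<Sum>a\<in>S. p a * g a) + \<eta>\<^sup>2 / 8 * cov S p g g \<le> ln (\<Sum>a\<in>S. p a * exp (\<eta> * g a))"
proof -
  define m where "m = (\<Sum>a\<in>S. p a * g a)"
  define V where "V = cov S p g g"
  define z where "z a = \<eta> * (g a - m)" for a
  have V0: "V \<ge> 0" unfolding V_def by (rule cov_self_nonneg[OF S(2)])
  have V2: "V \<le> 2" unfolding V_def using cov_self_le[OF S(2,3) g] by simp
  have "\<bar>m\<bar> \<le> (\<Sum>a\<in>S. \<bar>p a * g a\<bar>)" unfolding m_def by (rule sum_abs)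
  also have "\<dots> \<le> (\<Sum>a\<in>S. p a * 1)"
    using S(2) g by (intro sum_mono) (simp add: abs_mult mult_left_le)
  finally have m: "\<bar>m\<bar> \<le> 1" using S(3) by simp
  have z: "\<bar>z a\<bar> \<le> 1 / 2" if "a \<in> S" for a
  proof -
    have "\<eta> * \<bar>g a - m\<bar> \<le> 1 / 4 * 2" using g[OF that] m \<eta> by (intro mult_mono) auto
    then show ?thesis using \<eta> by (simp add: z_def abs_mult)
  qed
  have mgf: "(\<Sum>a\<in>S. p a * exp (\<eta> * g a)) = exp (\<eta> * m) * (\<Sum>a\<in>S. p a * exp (z a))"
    unfolding sum_distrib_left z_def
    by (intro sum.cong refl) (simp add: algebra_simps flip: exp_add)
  have pz: "(\<Sum>a\<in>S. p a * z a) = 0"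
  proof -
    have "(\<Sum>a\<in>S. p a * z a) = \<eta> * ((\<Sum>a\<in>S. p a * g a) - m * sum p S)"
      unfolding z_def sum_distrib_left sum_subtractf[symmetric]
      by (intro sum.cong refl) (simp add: algebra_simps)
    then show ?thesis by (simp add: S(3) m_def)
  qed
  have pz2: "(\<Sum>a\<in>S. p a * (z a)\<^sup>2) = \<eta>\<^sup>2 * V"
    unfolding V_def cov_self_eq[OF S(3) m_def] z_def sum_distrib_left
    by (intro sum.cong refl) (simp add: power_mult_distrib)
  have "(\<Sum>a\<in>S. p a * exp (z a)) \<le> (\<Sum>a\<in>S. p a * (1 + z a + (z a)\<^sup>2))"
    by (intro sum_mono mult_left_mono exp_quadratic_bounds z S)
  also have "\<dots> = 1 + \<eta>\<^sup>2 * V"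
    by (simp add: distrib_left sum.distrib pz pz2 S(3))
  finally have up: "(\<Sum>a\<in>S. p a * exp (z a)) \<le> 1 + \<eta>\<^sup>2 * V" .
  have "(\<Sum>a\<in>S. p a * (1 + z a + (z a)\<^sup>2 / 4)) \<le> (\<Sum>a\<in>S. p a * exp (z a))"
    by (intro sum_mono mult_left_mono exp_quadratic_bounds z S)
  moreover have "(\<Sum>a\<in>S. p a * (1 + z a + (z a)\<^sup>2 / 4)) = 1 + \<eta>\<^sup>2 * V / 4"
    by (simp add: distrib_left sum.distrib pz pz2 S(3) flip: sum_divide_distrib)
  ultimately have lo: "1 + \<eta>\<^sup>2 * V / 4 \<le> (\<Sum>a\<in>S. p a * exp (z a))" by simp
  have s0: "\<eta>\<^sup>2 * V \<ge> 0" using V0 by simp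
  then have pos: "(\<Sum>a\<in>S. p a * exp (z a)) > 0" using lo by linarith
  have ln: "ln (\<Sum>a\<in>S. p a * exp (\<eta> * g a)) = \<eta> * m + ln (\<Sum>a\<in>S. p a * exp (z a))"
    unfolding mgf using pos by (simp add: ln_mult)
  have "ln (\<Sum>a\<in>S. p a * exp (z a)) \<le> \<eta>\<^sup>2 * V"
    using ln_le_minus_one[OF pos] up by linarith
  then show "ln (\<Sum>a\<in>S. p a * exp (\<eta> * g a)) \<le> \<eta> * (\<Sum>a\<in>S. p a * g a) + \<eta>\<^sup>2 * cov S p g g"
    unfolding ln m_def[symmetric] V_def[symmetric] by simp
  define s where "s = \<eta>\<^sup>2 * V / 4"
  have "\<eta>\<^sup>2 * V \<le> (1 / 4)\<^sup>2 * 2"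
    using V0 V2 \<eta> by (intro mult_mono power_mono) auto
  also have "\<dots> \<le> 1" by (simp add: power2_eq_square)
  finally have s: "0 \<le> s" "s \<le> 1 / 2" using s0 unfolding s_def by linarith+
  have "s * s \<le> s * (1 / 2)" using s by (intro mult_left_mono) auto
  then have "s / 2 \<le> s - s\<^sup>2" by (simp add: power2_eq_square)
  also have "\<dots> \<le> ln (1 + s)" using s by (intro ln_one_plus_pos_lower_bound) auto
  also have "\<dots> \<le> ln (\<Sum>a\<in>S. p a * exp (z a))"
    using lo s by (simp add: s_def)
  finally show "\<eta> * (\<Sum>a\<in>S. p a * g a) + \<eta>\<^sup>2 / 8 * cov S p g g \<le> ln (\<Sum>a\<in>S. p a * exp (\<eta> * g a))"
    unfolding ln m_def[symmetric] V_def[symmetric] s_def by simp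
qed

section \<open>Second-order regret bound in self-play\<close>

context oh_play
begin

text \<open>The distribution is one round ahead: the strategy of round \<open>s + 1\<close> is
  computed with \<open>Lo s\<close> as the prediction of \<open>Lo (s + 1)\<close>. Order 1 is thus
  the variance of the prediction error under the strategy that relied on the prediction.\<close>

definition loss_var :: "nat \<Rightarrow> nat \<Rightarrow> nat \<Rightarrow> real" where
  "loss_var i h s = cov (actions d i) (X (Suc s) i)
     (\<lambda>a. fdiff h (\<lambda>r. Lo r i a) s) (\<lambda>a. fdiff h (\<lambda>r. Lo r i a) s)"

lemma X_proportional:
  assumes "i \<in> {1..n}"
  shows "X (Suc s) i a = exp (- \<eta> * ((\<Sum>r=1..s. Lo r i a) + Lo s i a)) /
    (\<Sum>b\<in>actions d i. exp (- \<eta> * ((\<Sum>r=1..s. Lo r i b) + Lo s i b)))"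
proof -
  \<comment> \<open>The lower boundary term of the telescoping sum vanishes because round 0 has loss
    zero. What remains is the cumulative loss with the last round counted twice.\<close>
  have tele: "(\<Sum>r\<in>{1..<Suc s}. 2 * Lo r i b - Lo (r - 1) i b) = (\<Sum>r=1..s. Lo r i b) + Lo s i b" for b
    by (induction s) auto
  have "d i \<ge> 1" using game assms by (auto simp: game_def)
  then show ?thesis
    using X_closed_form[OF assms, of 1 "Suc s" a]
    unfolding logit_change_def tele
    by (simp add: sum_divide_distrib[symmetric])
qed

text \<open>Potential argument with the partition function \<open>Z\<close> of the true cumulative
  losses. Divided by the normaliser \<open>Y s\<close> of the strategy of round
  \<open>s + 1\<close>, both \<open>Z (Suc s)\<close> and \<open>Z s\<close> are moment generating
  functions under that strategy. The upper bound on the first costs the variance of the prediction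
  error, the lower bound on the second gains 1 / 8 of the variance of the prediction, and the linear
  terms combine to the loss incurred.\<close>

lemma regret_le_variances:
  assumes i: "i \<in> {1..n}" and \<eta>: "\<eta> \<le> 1 / 4"
  shows "oh_regret n d l \<eta> i T \<le> ln (real (d i)) / \<eta> +
     \<eta> * (\<Sum>s<T. loss_var i 1 s - 1 / 8 * loss_var i 0 s)"
proof -
  let ?S = "actions d i"
  define L where "L t a = (\<Sum>r=1..t. Lo r i a)" for t a
  define Z where "Z t = (\<Sum>a\<in>?S. exp (- \<eta> * L t a))" for t
  define Y where "Y s = (\<Sum>b\<in>?S. exp (- \<eta> * (L s b + Lo s i b)))" for s
  have ne: "?S \<noteq> {}" by (rule actions_nonempty[OF i])
  have Zp: "Z t > 0" for t unfolding Z_def using ne by (intro sum_pos) auto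
  have Yp: "Y s > 0" for s unfolding Y_def using ne by (intro sum_pos) auto
  have X: "X (Suc s) i a = exp (- \<eta> * (L s a + Lo s i a)) / Y s" for s a
    unfolding L_def Y_def by (rule X_proportional[OF i])
  have step: "ln (Z (Suc s)) - ln (Z s) \<le> - \<eta> * (\<Sum>a\<in>?S. X (Suc s) i a * Lo (Suc s) i a)
      + \<eta>\<^sup>2 * (loss_var i 1 s - 1 / 8 * loss_var i 0 s)" for s
  proof -
    let ?p = "X (Suc s) i"
    let ?g = "\<lambda>a. Lo s i a - Lo (Suc s) i a"
    have p: "\<And>a. a \<in> ?S \<Longrightarrow> ?p a \<ge> 0" "sum ?p ?S = 1"
      using X_pos[OF i, of "Suc s"] X_sum[OF i, of "Suc s"] by (auto simp: less_imp_le)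
    have g: "\<bar>?g a\<bar> \<le> 1" "\<bar>Lo s i a\<bar> \<le> 1" if "a \<in> ?S" for a
      using Lo_bounds[OF i that, of s] Lo_bounds[OF i that, of "Suc s"] by linarith+
    have "(\<Sum>a\<in>?S. ?p a * exp (\<eta> * ?g a)) = Z (Suc s) / Y s"
      unfolding X Z_def sum_divide_distrib
      by (intro sum.cong refl) (simp add: L_def algebra_simps flip: exp_add)
    then have e1: "ln (Z (Suc s)) = ln (Y s) + ln (\<Sum>a\<in>?S. ?p a * exp (\<eta> * ?g a))"
      using Zp[of "Suc s"] Yp[of s] by (simp add: ln_div)
    have "(\<Sum>a\<in>?S. ?p a * exp (\<eta> * Lo s i a)) = Z s / Y s"
      unfolding X Z_def sum_divide_distrib
      by (intro sum.cong refl) (simp add: algebra_simps flip: exp_add)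
    then have e0: "ln (Z s) = ln (Y s) + ln (\<Sum>a\<in>?S. ?p a * exp (\<eta> * Lo s i a))"
      using Zp[of s] Yp[of s] by (simp add: ln_div)
    have v1: "cov ?S ?p ?g ?g = loss_var i 1 s"
      unfolding loss_var_def cov_def
      by (intro arg_cong2[where f = "(/)"] sum.cong refl) (simp add: algebra_simps)
    have v0: "cov ?S ?p (\<lambda>a. Lo s i a) (\<lambda>a. Lo s i a) = loss_var i 0 s"
      by (simp add: loss_var_def)
    have mean: "(\<Sum>a\<in>?S. ?p a * ?g a) = (\<Sum>a\<in>?S. ?p a * Lo s i a) - (\<Sum>a\<in>?S. ?p a * Lo (Suc s) i a)"
      by (simp only: right_diff_distrib sum_subtractf)
    have up: "ln (\<Sum>a\<in>?S. ?p a * exp (\<eta> * ?g a)) \<le>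
        \<eta> * (\<Sum>a\<in>?S. ?p a * ?g a) + \<eta>\<^sup>2 * cov ?S ?p ?g ?g"
      by (rule ln_mgf_bounds(1)) (use p g \<eta> eta_pos in auto)
    have lo: "\<eta> * (\<Sum>a\<in>?S. ?p a * Lo s i a) + \<eta>\<^sup>2 / 8 * cov ?S ?p (\<lambda>a. Lo s i a) (\<lambda>a. Lo s i a)
        \<le> ln (\<Sum>a\<in>?S. ?p a * exp (\<eta> * Lo s i a))"
      by (rule ln_mgf_bounds(2)) (use p g \<eta> eta_pos in auto)
    have "y + u - (y + w) \<le> - \<eta> * m1 + \<eta>\<^sup>2 * (c1 - 1 / 8 * c0)"
      if "u \<le> \<eta> * (m0 - m1) + \<eta>\<^sup>2 * c1" "\<eta> * m0 + \<eta>\<^sup>2 / 8 * c0 \<le> w" for y u w m0 m1 c0 c1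
      using that by (simp add: algebra_simps)
    from this[OF up[unfolded mean v1] lo[unfolded v0]] show ?thesis unfolding e1 e0 .
  qed
  have "ln (Z T) - ln (Z 0) = (\<Sum>s<T. ln (Z (Suc s)) - ln (Z s))"
    by (rule sum_lessThan_telescope[symmetric])
  also have "\<dots> \<le> (\<Sum>s<T. - \<eta> * (\<Sum>a\<in>?S. X (Suc s) i a * Lo (Suc s) i a)
      + \<eta>\<^sup>2 * (loss_var i 1 s - 1 / 8 * loss_var i 0 s))"
    by (intro sum_mono step)
  also have "\<dots> = - \<eta> * (\<Sum>s<T. \<Sum>a\<in>?S. X (Suc s) i a * Lo (Suc s) i a)
      + \<eta>\<^sup>2 * (\<Sum>s<T. loss_var i 1 s - 1 / 8 * loss_var i 0 s)"
    by (simp only: sum.distrib sum_distrib_left[symmetric])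
  also have "(\<Sum>s<T. \<Sum>a\<in>?S. X (Suc s) i a * Lo (Suc s) i a) = (\<Sum>t=1..T. \<Sum>a\<in>?S. X t i a * Lo t i a)"
    by (rule sum.reindex_bij_witness[of _ "\<lambda>t. t - 1" Suc]) auto
  finally have tel: "ln (Z T) - ln (Z 0) \<le> - \<eta> * (\<Sum>t=1..T. \<Sum>a\<in>?S. X t i a * Lo t i a)
      + \<eta>\<^sup>2 * (\<Sum>s<T. loss_var i 1 s - 1 / 8 * loss_var i 0 s)" .
  have Z0: "Z 0 = real (d i)" by (simp add: Z_def L_def actions_def)
  have "Min (L T ` ?S) \<in> L T ` ?S" using ne by (intro Min_in) auto
  then obtain a where a: "a \<in> ?S" "Min (L T ` ?S) = L T a" by blast
  have "exp (- \<eta> * L T a) \<le> Z T"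
    unfolding Z_def using a(1) by (intro member_le_sum) auto
  then have "- \<eta> * L T a \<le> ln (Z T)"
    using Zp[of T] by (simp add: ln_ge_iff)
  then have "\<eta> * ((\<Sum>t=1..T. \<Sum>a\<in>?S. X t i a * Lo t i a) - L T a)
      \<le> ln (real (d i)) + \<eta>\<^sup>2 * (\<Sum>s<T. loss_var i 1 s - 1 / 8 * loss_var i 0 s)"
    using tel unfolding Z0 by (simp add: algebra_simps)
  moreover have "oh_regret n d l \<eta> i T = (\<Sum>t=1..T. \<Sum>a\<in>?S. X t i a * Lo t i a) - L T a"
    unfolding oh_regret_def using a(2) by (simp add: L_def)
  ultimately have "\<eta> * oh_regret n d l \<eta> i T
      \<le> ln (real (d i)) + \<eta>\<^sup>2 * (\<Sum>s<T. loss_var i 1 s - 1 / 8 * loss_var i 0 s)" by simp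
  then have "oh_regret n d l \<eta> i T
      \<le> (ln (real (d i)) + \<eta>\<^sup>2 * (\<Sum>s<T. loss_var i 1 s - 1 / 8 * loss_var i 0 s)) / \<eta>"
    using eta_pos by (simp add: pos_le_divide_eq mult.commute)
  then show ?thesis using eta_pos by (simp add: add_divide_distrib power2_eq_square)
qed

text \<open>Closeness must be relative, since probabilities may be tiny. Weights and normaliser lie
  between \<open>exp (- (3 * \<eta>))\<close> and \<open>exp (3 * \<eta>)\<close>; two of each enter
  \<open>r\<close>, which gives \<open>exp (12 * \<eta>) \<le> 1 + 24 * \<eta>\<close>.\<close>

lemma X_pair_change:
  assumes i: "i \<in> {1..n}" and \<eta>: "24 * \<eta> \<le> 1" and ab: "a \<in> actions d i" "b \<in> actions d i" and t: "t \<ge> 1"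
  shows "\<bar>X t i a * X t i b - X (Suc t) i a * X (Suc t) i b\<bar>
     \<le> 24 * \<eta> * (X (Suc t) i a * X (Suc t) i b)"
proof -
  define e where "e c = exp (- \<eta> * (2 * Lo t i c - Lo (t - 1) i c))" for c
  define Z where "Z = (\<Sum>c\<in>actions d i. X t i c * e c)"
  have e: "exp (- (3 * \<eta>)) \<le> e c" "e c \<le> exp (3 * \<eta>)" if "c \<in> actions d i" for c
  proof -
    have "\<bar>2 * Lo t i c - Lo (t - 1) i c\<bar> \<le> 3"
      using Lo_bounds[OF i that, of t] Lo_bounds[OF i that, of "t - 1"] by linarith
    then have "\<eta> * \<bar>2 * Lo t i c - Lo (t - 1) i c\<bar> \<le> \<eta> * 3" using eta_pos by (intro mult_left_mono) auto
    then have "\<bar>- \<eta> * (2 * Lo t i c - Lo (t - 1) i c)\<bar> \<le> 3 * \<eta>"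
      using eta_pos by (simp add: abs_mult)
    then have "- (3 * \<eta>) \<le> - \<eta> * (2 * Lo t i c - Lo (t - 1) i c)"
      "- \<eta> * (2 * Lo t i c - Lo (t - 1) i c) \<le> 3 * \<eta>" by linarith+
    then show "exp (- (3 * \<eta>)) \<le> e c" "e c \<le> exp (3 * \<eta>)" unfolding e_def exp_le_cancel_iff .
  qed
  have p: "\<And>c. c \<in> actions d i \<Longrightarrow> X t i c > 0" using X_pos[OF i t] .
  have "(\<Sum>c\<in>actions d i. X t i c * exp (- (3 * \<eta>))) \<le> Z" "Z \<le> (\<Sum>c\<in>actions d i. X t i c * exp (3 * \<eta>))"
    unfolding Z_def using e p by (auto intro!: sum_mono mult_left_mono simp: less_imp_le)
  then have Z: "exp (- (3 * \<eta>)) \<le> Z" "Z \<le> exp (3 * \<eta>)"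
    unfolding sum_distrib_right[symmetric] X_sum[OF i t] by simp_all
  have Zp: "Z > 0" using Z(1) exp_gt_zero[of "- (3 * \<eta>)"] by linarith
  have ep: "e c > 0" for c by (simp add: e_def)
  have X': "X (Suc t) i c = X t i c * e c / Z" for c
    unfolding e_def Z_def by (rule X_step[OF t])
  define r where "r = Z\<^sup>2 / (e a * e b)"
  have eq: "X t i a * X t i b = r * (X (Suc t) i a * X (Suc t) i b)"
    unfolding X' r_def using Zp ep[of a] ep[of b] by (simp add: field_simps power2_eq_square)
  have "Z\<^sup>2 \<le> (exp (3 * \<eta>))\<^sup>2" using Z Zp by (intro power_mono) auto
  moreover have "(exp (- (3 * \<eta>)))\<^sup>2 \<le> Z\<^sup>2" using Z by (intro power_mono) auto
  moreover have "exp (- (3 * \<eta>)) * exp (- (3 * \<eta>)) \<le> e a * e b" "e a * e b \<le> exp (3 * \<eta>) * exp (3 * \<eta>)"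
    using e[OF ab(1)] e[OF ab(2)] ep by (auto intro!: mult_mono simp: less_imp_le)
  ultimately have "r \<le> (exp (3 * \<eta>))\<^sup>2 / (exp (- (3 * \<eta>)) * exp (- (3 * \<eta>)))"
     "(exp (- (3 * \<eta>)))\<^sup>2 / (exp (3 * \<eta>) * exp (3 * \<eta>)) \<le> r"
    unfolding r_def using ep by (auto intro!: frac_le)
  then have r: "r \<le> exp (12 * \<eta>)" "exp (- (12 * \<eta>)) \<le> r"
    by (simp_all add: power2_eq_square exp_minus field_simps flip: exp_add)
  have "exp (12 * \<eta>) \<le> 1 + 24 * \<eta>"
    using exp_bound_lemma[of "12 * \<eta>"] \<eta> eta_pos by simp
  moreover have "1 - 12 * \<eta> \<le> exp (- (12 * \<eta>))"
    using exp_ge_add_one_self[of "- (12 * \<eta>)"] by simp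
  ultimately have "\<bar>r - 1\<bar> \<le> 24 * \<eta>" using r eta_pos by linarith
  moreover have "X (Suc t) i a * X (Suc t) i b > 0"
    using X_pos[OF i] ab by simp
  moreover have "X t i a * X t i b - X (Suc t) i a * X (Suc t) i b = (r - 1) * (X (Suc t) i a * X (Suc t) i b)"
    unfolding eq by (simp add: algebra_simps)
  ultimately show ?thesis by (simp only: abs_mult[of "r - 1"] abs_of_pos mult_right_mono less_imp_le)
qed

lemma loss_var_nonneg: "i \<in> {1..n} \<Longrightarrow> loss_var i h s \<ge> 0"
  unfolding loss_var_def using X_pos[of i "Suc s"] by (intro cov_self_nonneg) (auto simp: less_imp_le)

lemma loss_var_le:
  assumes "i \<in> {1..n}" "\<And>a. a \<in> actions d i \<Longrightarrow> \<bar>fdiff h (\<lambda>r. Lo r i a) s\<bar> \<le> B"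
  shows "loss_var i h s \<le> 2 * B\<^sup>2"
  unfolding loss_var_def
proof (rule cov_self_le)
  show "X (Suc s) i a \<ge> 0" if "a \<in> actions d i" for a
    using X_pos[OF assms(1) _ that, of "Suc s"] by simp
  show "sum (X (Suc s) i) (actions d i) = 1" using X_sum[OF assms(1)] by simp
qed (rule assms(2))

lemma loss_var_single_action:
  assumes "d i = 1"
  shows "loss_var i h s = 0"
  using assms by (simp add: loss_var_def cov_def actions_def)

lemma loss_var_1_le:
  assumes "i \<in> {1..n}"
  shows "loss_var i 1 s \<le> 2"
proof -
  have "\<bar>fdiff 1 (\<lambda>r. Lo r i a) s\<bar> \<le> 1" if "a \<in> actions d i" for a
    using Lo_bounds[OF assms that, of s] Lo_bounds[OF assms that, of "Suc s"]
    by (simp del: oh_loss.simps) linarith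
  from loss_var_le[OF assms this] show ?thesis by simp
qed

end

section \<open>Explicit constants for the tuned step size\<close>

lemma weight_le_power:
  assumes "A \<ge> 0" "k \<le> H"
  shows "weight A k \<le> (real H * A) ^ k"
proof -
  have "fact k * A ^ k / (real k + 1)\<^sup>2 \<le> fact k * A ^ k / 1"
    using assms by (intro divide_left_mono) (auto simp: one_le_power)
  also have "\<dots> \<le> real H ^ k * A ^ k"
  proof -
    have "fact k \<le> real k ^ k" using fact_le_power[of k, where 'a=real] by simp
    also have "\<dots> \<le> real H ^ k" using assms by (intro power_mono) auto
    finally show ?thesis using assms by (simp add: mult_right_mono)
  qed
  finally show ?thesis by (simp add: weight_def power_mult_distrib)
qed

locale oh_tuned = oh_play n d l \<eta> for n d l \<eta> +
  fixes T :: nat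
  assumes T1: "T \<ge> 1"
    and tuned: "\<eta> = 1 / 60000 / (sqrt (real n) * ln (real T + 2))"
begin

text \<open>
  The highest order of differences. The loss differences of order \<open>H\<close> are so small that even summed
  over all \<open>T\<close> rounds they only contribute a constant.
\<close>

definition H :: nat where "H = nat \<lceil>ln (real T + 2)\<rceil>"

lemma log_ge_1: "ln (real T + 2) \<ge> 1"
proof -
  have "exp 1 \<le> real T + 2" using T1 exp_le by simp
  then show ?thesis by (simp add: ln_ge_iff)
qed

lemma n1: "n \<ge> 1"
  using game by (simp add: game_def)

lemma sqrt_n: "sqrt (real n) \<ge> 1"
  using n1 by simp

lemma H_bounds: "ln (real T + 2) \<le> real H" "real H \<le> 2 * ln (real T + 2)" "H \<ge> 1"
proof -
  have H: "real H = real_of_int \<lceil>ln (real T + 2)\<rceil>" unfolding H_def using log_ge_1 by simp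
  show "ln (real T + 2) \<le> real H" unfolding H by (rule le_of_int_ceiling)
  then show "H \<ge> 1" using log_ge_1 by linarith
  show "real H \<le> 2 * ln (real T + 2)" unfolding H using log_ge_1 by linarith
qed

lemma eta_log: "\<eta> * sqrt (real n) * ln (real T + 2) = 1 / 60000"
  using tuned log_ge_1 sqrt_n by simp

lemma eta_H: "\<eta> * sqrt (real n) * real H \<le> 1 / 30000"
proof -
  have "\<eta> * sqrt (real n) * real H \<le> \<eta> * sqrt (real n) * (2 * ln (real T + 2))"
    using eta_pos H_bounds by (intro mult_left_mono) auto
  then show ?thesis using eta_log by simp
qed

lemma eta_H': "\<eta> * real H \<le> 1 / 30000"
proof -
  have "\<eta> * 1 * real H \<le> \<eta> * sqrt (real n) * real H"
    using eta_pos sqrt_n by (intro mult_mono) auto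
  then show ?thesis using eta_H by simp
qed

lemma eta_le: "\<eta> \<le> 1 / 30000"
proof -
  have "\<eta> * 1 \<le> \<eta> * real H" using eta_pos H_bounds by (intro mult_left_mono) auto
  then show ?thesis using eta_H' by simp
qed

lemma loss_fdiff_geometric:
  assumes i: "i \<in> {1..n}" and a: "a \<in> actions d i" and h: "h \<le> H" and t: "H < t"
  shows "\<bar>fdiff h (\<lambda>s. Lo s i a) t\<bar> \<le> 2 * (1 / 14) ^ h"
proof -
  \<comment> \<open>\<open>M\<close> makes \<open>(1 + (80 * M)\<^sup>2) ^ n\<close> equal to
    \<open>(1 + 1 / n) ^ n\<close>, which is at most \<open>exp 1\<close>. Then
    \<open>24 * \<eta> \<le> M * A\<close> dictates \<open>1920 = 24 * 80\<close>, and the 1 / 60000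
    in the step size makes \<open>real H * A\<close> at most \<open>1920 / 30000\<close>, below 1 /
    14.\<close>
  define A where "A = 1920 * \<eta> * sqrt (real n)"
  define M where "M = 1 / (80 * sqrt (real n))"
  have A: "A > 0" using eta_pos n1 by (simp add: A_def)
  have "\<bar>fdiff h (\<lambda>s. Lo s i a) t\<bar> \<le> 2 * weight A h"
  proof (rule fdiff_loss_le[OF A])
    have "32 \<le> 80 * sqrt (real n)" using sqrt_n by linarith
    then show "32 * M \<le> 1" using n1 by (simp add: M_def divide_le_eq)
    show "24 * \<eta> \<le> M * A" using n1 by (simp add: M_def A_def)
    have "240 * (\<eta> * sqrt (real n) * real H) \<le> 1" using eta_H by simp
    then show "3 * \<eta> * real H \<le> M" using n1 by (simp add: M_def pos_le_divide_eq algebra_simps)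
    have "(1 + (80 * M)\<^sup>2) ^ n = (1 + 1 / real n) ^ n"
      using n1 by (simp add: M_def power_divide)
    also have "\<dots> \<le> exp (1 / real n) ^ n"
      using exp_ge_add_one_self[of "1 / real n"] by (intro power_mono) auto
    also have "\<dots> = exp 1" using n1 by (simp flip: exp_of_nat_mult)
    finally show "(1 + (80 * M)\<^sup>2) ^ n \<le> 4" using exp_le by simp
  qed (use i a h t in auto)
  also have "\<dots> \<le> 2 * (real H * A) ^ h"
    using A h by (simp add: weight_le_power)
  also have "\<dots> \<le> 2 * (1 / 14) ^ h"
  proof -
    have "real H * A = 1920 * (\<eta> * sqrt (real n) * real H)" by (simp add: A_def)
    also have "\<dots> \<le> 1 / 14" using eta_H by simp
    finally show ?thesis using A by (intro mult_left_mono power_mono) auto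
  qed
  finally show ?thesis .
qed

text \<open>The square of 14 is 196, rounded to \<open>192 = 3 * 64\<close>: at order
  \<open>H\<close> the factor \<open>3 ^ H\<close> pays for the sum over the rounds, because
  \<open>T \<le> exp H\<close>, and 64 is the rate that \<open>contraction_recursion\<close>
  expects.\<close>

lemma loss_var_geometric:
  assumes i: "i \<in> {1..n}" and h: "h \<le> H" and s: "H < s"
  shows "loss_var i h s \<le> 8 / 192 ^ h"
proof -
  have "loss_var i h s \<le> 2 * (2 * (1 / 14) ^ h)\<^sup>2"
    using loss_fdiff_geometric[OF i _ h s] by (rule loss_var_le[OF i])
  also have "\<dots> = 8 * (1 / 196) ^ h"
    by (simp add: power_mult_distrib power2_eq_square flip: power_mult_distrib)
  also have "\<dots> \<le> 8 * (1 / 192) ^ h" by (intro mult_left_mono power_mono) auto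
  finally show ?thesis by (simp add: power_one_over)
qed

lemma variance_contraction:
  assumes i: "i \<in> {1..n}" and T: "Suc H \<le> T"
  shows "(\<Sum>s=Suc H..<T. loss_var i 1 s) \<le> 1 / 8 * (\<Sum>s=Suc H..<T. loss_var i 0 s) + 80"
proof (rule contraction_recursion[where \<epsilon> = "24 * \<eta>" and H = H and \<beta> = "\<lambda>h. 8 / 192 ^ h"])
  show "0 \<le> (\<Sum>s=Suc H..<T. loss_var i h s)" for h
    using loss_var_nonneg[OF i] by (intro sum_nonneg) auto
  show "0 \<le> 24 * \<eta>" using eta_pos by simp
  show "40 * (24 * \<eta>) * real H \<le> 1" using eta_H' by simp
  show "1 \<le> H" by (rule H_bounds)
  show "8 / 192 ^ h \<le> (8 / 64 ^ h :: real)" for h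
    by (intro divide_left_mono power_mono) auto
  show "(\<Sum>s=Suc H..<T. loss_var i H s) \<le> 80 / 64 ^ (H - 1)"
  proof -
    have "(\<Sum>s=Suc H..<T. loss_var i H s) \<le> (\<Sum>s=Suc H..<T. 8 / 192 ^ H)"
      using loss_var_geometric[OF i] by (intro sum_mono) auto
    also have "\<dots> \<le> real T * (8 / 192 ^ H)"
      by (simp add: divide_right_mono)
    also have "\<dots> \<le> 3 ^ H * (8 / 192 ^ H)"
    proof (rule mult_right_mono)
      have "real T + 2 = exp (ln (real T + 2))" by simp
      also have "\<dots> \<le> exp (real H)" using H_bounds(1) by (simp only: exp_le_cancel_iff)
      also have "\<dots> = exp 1 ^ H" by (simp flip: exp_of_nat_mult)
      also have "\<dots> \<le> 3 ^ H" using exp_le by (intro power_mono) auto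
      finally show "real T \<le> 3 ^ H" by linarith
    qed simp
    also have "\<dots> = 8 / 64 ^ H"
      using power_mult_distrib[of "3::real" 64 H] by simp
    also have "\<dots> \<le> 80 / 64 ^ (H - 1)"
      using H_bounds(3) by (intro frac_le power_increasing) auto
    finally show ?thesis .
  qed
  fix h and \<theta> :: real
  assume h: "Suc (Suc h) \<le> H" and \<theta>: "\<theta> > 0"
  show "(\<Sum>s=Suc H..<T. loss_var i (Suc h) s) \<le> 2 * (8 / 192 ^ h) +
      24 * \<eta> / 2 * ((\<Sum>s=Suc H..<T. loss_var i (Suc h) s) + (\<Sum>s=Suc H..<T. loss_var i h s) + 2 * (8 / 192 ^ h)) +
      \<theta> / 2 * (\<Sum>s=Suc H..<T. loss_var i (Suc (Suc h)) s) +
      (1 + 24 * \<eta>) / (2 * \<theta>) * ((\<Sum>s=Suc H..<T. loss_var i h s) + 8 / 192 ^ h)"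
    unfolding loss_var_def
  proof (rule variance_sum_step[where p = "\<lambda>s. X (Suc s) i" and f = "\<lambda>r. Lo r i", OF _ _ \<theta> _ T])
    show "0 \<le> X (Suc s) i a" if "a \<in> actions d i" for s a
      using X_pos[OF i _ that, of "Suc s"] by simp
    show "\<bar>X (Suc s) i a * X (Suc s) i b - X (Suc (Suc s)) i a * X (Suc (Suc s)) i b\<bar>
      \<le> 24 * \<eta> * (X (Suc (Suc s)) i a * X (Suc (Suc s)) i b)"
      if "a \<in> actions d i" "b \<in> actions d i" for s a b
      using X_pair_change[OF i _ that, of "Suc s"] eta_le by simp
    show "0 \<le> 24 * \<eta>" using eta_pos by simp
    fix s assume s: "Suc H \<le> s"
    show "cov (actions d i) (X (Suc s) i) (\<lambda>a. fdiff h (\<lambda>r. Lo r i a) s) (\<lambda>a. fdiff h (\<lambda>r. Lo r i a) s)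
      \<le> 8 / 192 ^ h"
      using loss_var_geometric[OF i, of h s] h s unfolding loss_var_def by simp
    have "cov (actions d i) (X (Suc s) i) (\<lambda>a. fdiff (Suc h) (\<lambda>r. Lo r i a) s) (\<lambda>a. fdiff (Suc h) (\<lambda>r. Lo r i a) s)
      \<le> 8 / 192 ^ Suc h"
      using loss_var_geometric[OF i, of "Suc h" s] h s unfolding loss_var_def by simp
    also have "\<dots> \<le> 8 / 192 ^ h" by (intro divide_left_mono power_increasing) auto
    finally show "cov (actions d i) (X (Suc s) i) (\<lambda>a. fdiff (Suc h) (\<lambda>r. Lo r i a) s)
        (\<lambda>a. fdiff (Suc h) (\<lambda>r. Lo r i a) s) \<le> 8 / 192 ^ h" .
  qed
qed

lemma variance_gap_le:
  assumes i: "i \<in> {1..n}"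
  shows "(\<Sum>s<T. loss_var i 1 s - 1 / 8 * loss_var i 0 s) \<le> 2 * real (Suc H) + 80"
proof -
  let ?v = "\<lambda>s. loss_var i 1 s - 1 / 8 * loss_var i 0 s"
  have v2: "?v s \<le> 2" for s using loss_var_1_le[OF i, of s] loss_var_nonneg[OF i, of 0 s] by linarith
  show ?thesis
  proof (cases "Suc H \<le> T")
    case True
    have "(\<Sum>s<T. ?v s) = (\<Sum>s<Suc H. ?v s) + (\<Sum>s=Suc H..<T. ?v s)"
      using True unfolding lessThan_atLeast0 by (intro sum.atLeastLessThan_concat[symmetric]) auto
    \<comment> \<open>In the early rounds high-order differences are not controlled; each round is
      bounded on its own, at a total cost of O(H).\<close>
    also have "(\<Sum>s<Suc H. ?v s) \<le> real (card {..<Suc H}) * 2"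
      using v2 by (intro sum_bounded_above)
    also have "(\<Sum>s=Suc H..<T. ?v s) \<le> 80"
      using variance_contraction[OF i True] by (simp only: sum_subtractf sum_distrib_left[symmetric])
    finally show ?thesis by simp
  next
    case False
    have "(\<Sum>s<T. ?v s) \<le> real (card {..<T}) * 2"
      using v2 by (intro sum_bounded_above)
    also have "\<dots> \<le> real (Suc H) * 2" using False by simp
    finally show ?thesis by simp
  qed
qed

lemma regret_le:
  assumes i: "i \<in> {1..n}"
  shows "oh_regret n d l \<eta> i T \<le> 60002 * sqrt (real n) * ln (real (d i)) * ln (real T + 2)"
proof -
  let ?L = "ln (real T + 2)" and ?G = "\<Sum>s<T. loss_var i 1 s - 1 / 8 * loss_var i 0 s"
  have reg: "oh_regret n d l \<eta> i T \<le> ln (real (d i)) / \<eta> + \<eta> * ?G"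
    using regret_le_variances[OF i] eta_le by simp
  \<comment> \<open>With one action \<open>ln (d i)\<close> is 0, leaving no room for an additive
    constant, but all variances vanish. Otherwise \<open>ln (d i) \<ge> 1 / 2\<close> absorbs the
    remainder, hence \<open>60002 = 60000 + 2\<close>.\<close>
  show ?thesis
  proof (cases "d i = 1")
    case True
    then show ?thesis using reg loss_var_single_action[of i] by simp
  next
    case False
    then have d2: "d i \<ge> 2" using game i by (force simp: game_def)
    have "ln 2 \<ge> (1 / 2 :: real)"
      using ln2_ge_two_thirds by simp
    also have "ln 2 \<le> ln (real (d i))" using d2 by simp
    finally have ld: "ln (real (d i)) \<ge> 1 / 2" .
    have inv: "1 / \<eta> = 60000 * sqrt (real n) * ?L"
      using eta_log eta_pos by (simp add: field_simps)
    have "\<eta> * ?G \<le> \<eta> * (2 * real (Suc H) + 80)"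
      using eta_pos variance_gap_le[OF i] by (intro mult_left_mono) auto
    also have "\<dots> = 2 * (\<eta> * real H) + 82 * \<eta>" by (simp add: algebra_simps)
    also have "\<dots> \<le> 2 * (1 * (1 / 2) * 1)" using eta_H' eta_le by simp
    also have "\<dots> \<le> 2 * (sqrt (real n) * ln (real (d i)) * ?L)"
      using sqrt_n ld log_ge_1 by (intro mult_left_mono mult_mono) auto
    finally have "\<eta> * ?G \<le> 2 * (sqrt (real n) * ln (real (d i)) * ?L)" .
    moreover have "ln (real (d i)) / \<eta> = 60000 * (sqrt (real n) * ln (real (d i)) * ?L)"
      using inv by (simp add: divide_inverse)
    ultimately show ?thesis using reg by (simp add: algebra_simps)
  qed
qed

end

theorem corollary4p2:
  shows "\<exists>c C :: real. c > 0 \<and> C > 0 \<and>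
    (\<forall>(n::nat) (d :: nat \<Rightarrow> nat) (l :: nat \<Rightarrow> (nat \<Rightarrow> nat) \<Rightarrow> real) (T::nat).
      game n d l \<longrightarrow> T \<ge> 1 \<longrightarrow>
      (\<forall>i\<in>{1..n}.
        oh_regret n d l (c / (sqrt (real n) * ln (real T + 2))) i T
          \<le> C * sqrt (real n) * ln (real (d i)) * ln (real T + 2)))"
proof (intro exI conjI allI impI ballI)
  show "(1 / 60000 :: real) > 0" "(60002::real) > 0" by simp_all
  fix n d l and T i :: nat
  assume g: "game n d l" and T: "T \<ge> 1" and i: "i \<in> {1..n}"
  have "oh_tuned n d l (1 / 60000 / (sqrt (real n) * ln (real T + 2))) T"
  proof
    have "ln (real T + 2) > 0" "n \<ge> 1" using g by (auto simp: game_def)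
    then show "0 < 1 / 60000 / (sqrt (real n) * ln (real T + 2))" by simp
  qed (use g T in auto)
  from oh_tuned.regret_le[OF this i]
  show "oh_regret n d l (1 / 60000 / (sqrt (real n) * ln (real T + 2))) i T
    \<le> 60002 * sqrt (real n) * ln (real (d i)) * ln (real T + 2)" .
qed

end
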